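(* Let $p\in\mathbb{N}$, $n\in\mathbb{N}_0$, $\mathbf{b}\in\mathbb{C}^p$ and $0<x<1$. The function $\mathbf{a}\mapsto\widehat{G}_n(x)/\Gamma(\mathbf{a})$ (initially defined for $-\mathbf{a}\notin\mathbb{N}_0$) is entire in each component of $\mathbf{a}$, i.e. all apparent singularities are removable. If $a_i=-m_i$ with $m_i\in\mathbb{N}_0$ for $i=1,\dots,r$, $1\le r\le p$, and $\mathbf{a}=(-\mathbf{m},\mathbf{a}')$ with $\mathbf{m}=(m_1,\dots,m_r)$, then (the extended function satisfies) $$ \frac{\widehat{G}_n(x)}{\Gamma(\mathbf{a})}=\frac{x^{n-1}}{(n-1)!\,\Gamma(\mathbf{b})}\;{}_{p+1}F_p\!\left(-n+1,-\mathbf{m},\mathbf{a}';\mathbf{b};\frac1x\right), $$ where the right-hand side is $0$ for $n=0$ (convention $1/(-1)!=0$).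
   Context: $\mathbb{N}_0=\mathbb{N}\cup\{0\}$. For a vector $\mathbf{a}=(a_1,\dots,a_p)$: $\Gamma(\mathbf{a})=\prod_i\Gamma(a_i)$, $(\mathbf{a})_j=\prod_i(a_i)_j$, $\mathbf{a}+\mu=(a_1+\mu,\dots,a_p+\mu)$; conditions such as $-\mathbf{a}\notin\mathbb{N}_0$ are element-wise. For $0<t<1$ and $-\mathbf{a}\notin\mathbb{N}_0$, $$\widehat{G}_n(t)=G^{p,1}_{p+1,p+1}\!\left(t\,\Big|\begin{array}{l}n,\mathbf{b}+n-1\\ \mathbf{a}+n-1,0\end{array}\right)=\frac{1}{2\pi i}\int_{\mathcal{L}}\frac{\Gamma(\mathbf{a}+n-1+s)\,\Gamma(1-n-s)}{\Gamma(\mathbf{b}+n-1+s)\,\Gamma(1-s)}\,t^{-s}\,ds,$$ where $\mathcal{L}$ is a left loop (starting and ending at $-\infty$, traversed counterclockwise) that leaves all the points $1-a_j-n-l$, $l\in\mathbb{N}_0$, on its left and all the points $1-n+k$, $k\in\mathbb{N}_0$, on its right. The quotient $\frac{1}{\Gamma(\mathbf{b})}{}_{p+1}F_p(-n+1,\mathbf{a};\mathbf{b};y)$ is understood as the finite sum $\sum_{j=0}^{n-1}\frac{(1-n)_j(\mathbf{a})_j}{\Gamma(\mathbf{b}+j)\,j!}y^j$. *)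

theory Defs
  imports "HOL-Complex_Analysis.Complex_Analysis"
begin

text \<open>
  Parameter vectors in \<open>\<complex>\<^sup>p\<close> are lists of length \<open>p\<close>. The library's \<^const>\<open>Gamma\<close> is \<open>0\<close> at
  its poles and division by \<open>0\<close> gives \<open>0\<close>, so dividing by a product of Gamma values is
  multiplying by the entire function \<^const>\<open>rGamma\<close> of each argument.
\<close>

definition Gamma_vec :: "complex list \<Rightarrow> complex" where
  "Gamma_vec a = (\<Prod>c\<leftarrow>a. Gamma c)"

definition pochhammer_vec :: "complex list \<Rightarrow> nat \<Rightarrow> complex" where
  "pochhammer_vec a j = (\<Prod>c\<leftarrow>a. pochhammer c j)"

definition shift_vec :: "complex list \<Rightarrow> complex \<Rightarrow> complex list" where
  "shift_vec a \<mu> = map (\<lambda>c. c + \<mu>) a"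

text \<open>
  A left loop is given by its bounded part, a path \<open>g\<close>: the loop arrives at \<open>pathstart g\<close> along
  the horizontal ray from \<open>-\<infinity>\<close>, follows \<open>g\<close>, and returns to \<open>-\<infinity>\<close> along the horizontal ray
  from \<open>pathfinish g\<close>. Below it is cut off at real part \<open>T\<close>; integrals along the loop are limits
  as \<open>T\<close> tends to \<open>-\<infinity>\<close>.
\<close>

definition left_loop :: "(real \<Rightarrow> complex) \<Rightarrow> bool" where
  "left_loop g \<longleftrightarrow> valid_path g \<and> Im (pathstart g) < Im (pathfinish g)"

definition loop_cutoff :: "(real \<Rightarrow> complex) \<Rightarrow> real \<Rightarrow> real \<Rightarrow> complex" where
  "loop_cutoff g T =
     linepath (Complex T (Im (pathstart g))) (pathstart g) +++ g +++
     linepath (pathfinish g) (Complex T (Im (pathfinish g)))"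

definition closed_loop_cutoff :: "(real \<Rightarrow> complex) \<Rightarrow> real \<Rightarrow> real \<Rightarrow> complex" where
  "closed_loop_cutoff g T =
     loop_cutoff g T +++
     linepath (Complex T (Im (pathfinish g))) (Complex T (Im (pathstart g)))"

text \<open>
  The points on the left of a counterclockwise left loop are those that it encircles once, the
  points on its right those that it does not encircle.
\<close>

definition left_of_loop :: "(real \<Rightarrow> complex) \<Rightarrow> complex \<Rightarrow> bool" where
  "left_of_loop g z \<longleftrightarrow>
     (\<forall>\<^sub>F T in at_bot. z \<notin> path_image (closed_loop_cutoff g T) \<and>
        winding_number (closed_loop_cutoff g T) z = 1)"

definition right_of_loop :: "(real \<Rightarrow> complex) \<Rightarrow> complex \<Rightarrow> bool" where
  "right_of_loop g z \<longleftrightarrow>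
     (\<forall>\<^sub>F T in at_bot. z \<notin> path_image (closed_loop_cutoff g T) \<and>
        winding_number (closed_loop_cutoff g T) z = 0)"

definition has_loop_integral ::
    "(complex \<Rightarrow> complex) \<Rightarrow> complex \<Rightarrow> (real \<Rightarrow> complex) \<Rightarrow> bool" where
  "has_loop_integral f v g \<longleftrightarrow>
     (\<forall>\<^sub>F T in at_bot. f contour_integrable_on loop_cutoff g T) \<and>
     ((\<lambda>T. contour_integral (loop_cutoff g T) f) \<longlongrightarrow> v) at_bot"

definition Ghat_integrand ::
    "nat \<Rightarrow> complex list \<Rightarrow> complex list \<Rightarrow> real \<Rightarrow> complex \<Rightarrow> complex" where
  "Ghat_integrand n a b t s =
     (Gamma_vec (shift_vec a (of_nat n - 1 + s)) * Gamma (1 - of_nat n - s)) /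
     (Gamma_vec (shift_vec b (of_nat n - 1 + s)) * Gamma (1 - s)) *
     of_real t powr (- s)"

definition admissible_loop :: "nat \<Rightarrow> complex list \<Rightarrow> (real \<Rightarrow> complex) \<Rightarrow> bool" where
  "admissible_loop n a g \<longleftrightarrow>
     left_loop g \<and>
     (\<forall>c\<in>set a. \<forall>l::nat. left_of_loop g (1 - c - of_nat n - of_nat l)) \<and>
     (\<forall>k::nat. right_of_loop g (1 - of_nat n + of_nat k))"

text \<open>
  The value of the integral is the same for all admissible loops. It is meaningful only if
  no \<open>-c\<close> with \<open>c \<in> set a\<close> is a natural number, as there is no admissible loop otherwise.
\<close>

definition Ghat :: "nat \<Rightarrow> complex list \<Rightarrow> complex list \<Rightarrow> real \<Rightarrow> complex" where
  "Ghat n a b t =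
     (THE w. \<exists>g v. admissible_loop n a g \<and> has_loop_integral (Ghat_integrand n a b t) v g \<and>
        w = v / (2 * of_real pi * \<i>))"

text \<open>
  The terminating series for \<open>\<^sub>p\<^sub>+\<^sub>1F\<^sub>p(1 - n, a; b; y) / \<Gamma>(b)\<close>, with \<open>(b)\<^sub>j \<Gamma>(b)\<close> combined into
  \<open>\<Gamma>(b + j)\<close>, so that it makes sense for every \<open>b\<close>.
\<close>

definition hypergeo_over_Gamma ::
    "nat \<Rightarrow> complex list \<Rightarrow> complex list \<Rightarrow> complex \<Rightarrow> complex" where
  "hypergeo_over_Gamma n a b y =
     (\<Sum>j<n. pochhammer (1 - of_nat n) j * pochhammer_vec a j /
        (Gamma_vec (shift_vec b (of_nat j)) * fact j) * y ^ j)"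

definition entire_in_each_component :: "nat \<Rightarrow> (complex list \<Rightarrow> complex) \<Rightarrow> bool" where
  "entire_in_each_component p F \<longleftrightarrow>
     (\<forall>a i. length a = p \<longrightarrow> i < p \<longrightarrow> (\<lambda>z. F (a[i := z])) holomorphic_on UNIV)"

definition entire_extension_Ghat_quotient ::
    "nat \<Rightarrow> nat \<Rightarrow> complex list \<Rightarrow> real \<Rightarrow> (complex list \<Rightarrow> complex) \<Rightarrow> bool" where
  "entire_extension_Ghat_quotient p n b x F \<longleftrightarrow>
     entire_in_each_component p F \<and>
     (\<forall>a. length a = p \<longrightarrow> (\<forall>c\<in>set a. - c \<notin> \<nat>) \<longrightarrow> F a = Ghat n a b x / Gamma_vec a)"

end

theory Submission imports Defs begin

text \<open>
  On a loop that avoids the points \<open>1 - n + k\<close> the quotient \<open>\<Gamma>(1 - n - s) / \<Gamma>(1 - s)\<close> is the rational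
  function \<open>1 / (1 - n - s)\<^sub>n\<close>. The integrand is therefore a meromorphic function \<open>h\<close> whose poles lie on
  the sequences \<open>1 - c - n - l\<close>, for \<open>c\<close> in \<open>a\<close>, and at the finitely many points \<open>1 - n, \<dots>, 0\<close>. An
  admissible loop has the sequences on its left and the finite set on its right. Push it across the
  finite set, so that it encloses every pole. The integral changes by the residues at
  \<open>1 - n, \<dots>, 0\<close>; as long as no \<open>-c\<close> is a natural number these poles are at most simple, and the
  residues are, up to the factor \<open>\<Gamma>(a)\<close>, the terms of the terminating hypergeometric series. With \<open>I(a)\<close> for
  the integral along the enclosing loop, divided by \<open>2\<pi>\<i>\<close>, this gives (lemma \<open>Ghat_eq\<close>)
  \<open>G(x) / \<Gamma>(a) = x\<^sup>n\<^sup>-\<^sup>1 / (n - 1)! \<cdot> F(1 - n, a; b; 1 / x) / \<Gamma>(b) + I(a) / \<Gamma>(a)\<close>.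

  Nothing has to be separated by an enclosing loop, so \<open>I(a)\<close> is defined for every \<open>a\<close>, and it is
  entire in each component (lemma \<open>enclosing_integral_holomorphic\<close>). Hence the right-hand side is an
  extension that is entire in each component. As soon as one \<open>a\<^sub>i\<close> is a nonpositive integer, \<open>1 / \<Gamma>(a)\<close>
  vanishes and only the series remains. The values at such \<open>a\<close> are the same for every extension,
  because they are limits of values at other parameters (lemma \<open>entire_extension_unique\<close>).

  Three facts carry the argument. First, the recurrence of \<open>\<Gamma>\<close> shows that \<open>h(s - 1) / h(s)\<close> tends to
  \<open>x < 1\<close> as \<open>Re s\<close> tends to \<open>-\<infinity>\<close> (lemma \<open>Ghat_kernel_contracting\<close>). So \<open>h\<close> decays geometrically
  under unit shifts to the left, which makes the loop integrals converge, locally uniformly in \<open>a\<close>.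
  Secondly, the residue theorem for cut-off loops, with cut-offs that move to the left in unit steps
  and meet no pole, compares two loops (lemma \<open>loop_integral_compare\<close>). Thirdly, admissible loops
  exist although left and right points may alternate on the real axis (lemma
  \<open>separating_loop_exists\<close>): a loop may cross itself, and only its winding numbers matter.
\<close>

section \<open>Locally finite sets of points\<close>

definition locally_finite_points :: "complex set \<Rightarrow> bool" where
  "locally_finite_points D \<longleftrightarrow> (\<forall>B. finite (D \<inter> cball 0 B))"

lemma locally_finite_points_isolated:
  assumes "locally_finite_points D"
  shows "\<exists>e>0. cball z e \<inter> D \<subseteq> {z}"
proof -
  have "finite (D \<inter> cball 0 (norm z + 1))" using assms by (simp add: locally_finite_points_def)
  then obtain d where d: "d > 0" "\<And>w. w \<in> D \<inter> cball 0 (norm z + 1) \<Longrightarrow> w \<noteq> z \<Longrightarrow> d \<le> dist z w"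
    using finite_set_avoid by metis
  have "w = z" if "w \<in> cball z (min 1 (d / 2))" "w \<in> D" for w
  proof (rule ccontr)
    assume "w \<noteq> z"
    have "norm w \<le> norm z + 1"
      using that norm_triangle_ineq2[of w z] by (auto simp: dist_norm norm_minus_commute)
    then show False using d that \<open>w \<noteq> z\<close> by (fastforce simp: dist_norm)
  qed
  then show ?thesis using d(1) by (intro exI[of _ "min 1 (d / 2)"]) auto
qed

lemma locally_finite_points_closed:
  assumes "locally_finite_points D" shows "closed D"
proof -
  have "\<not> z islimpt D" for z
  proof
    assume "z islimpt D"
    obtain e where e: "e > 0" "cball z e \<inter> D \<subseteq> {z}"
      using locally_finite_points_isolated[OF assms] by blast
    have "infinite (D \<inter> ball z e)"
      using \<open>z islimpt D\<close> e(1) by (simp add: islimpt_eq_infinite_ball)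
    moreover have "D \<inter> ball z e \<subseteq> {z}" using e(2) ball_subset_cball[of z e] by blast
    ultimately show False by (meson finite.simps finite_subset)
  qed
  then show ?thesis by (simp add: closed_limpt)
qed

lemma locally_finite_points_countable:
  assumes "locally_finite_points D" shows "countable D"
proof -
  have "D = (\<Union>k::nat. D \<inter> cball 0 (real k))"
    using real_arch_simple by auto
  also have "countable \<dots>"
    using assms by (intro countable_UN) (auto simp: locally_finite_points_def countable_finite)
  finally show ?thesis .
qed

lemma locally_finite_points_Un:
  "locally_finite_points A \<Longrightarrow> locally_finite_points B \<Longrightarrow> locally_finite_points (A \<union> B)"
  by (simp add: locally_finite_points_def Int_Un_distrib2)

definition left_discrete :: "complex set \<Rightarrow> bool" where
  "left_discrete P \<longleftrightarrow> (\<forall>T. finite {p \<in> P. T \<le> Re p})"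

lemma left_discrete_subset:
  assumes "left_discrete P" "Q \<subseteq> P" shows "left_discrete Q"
  unfolding left_discrete_def
proof
  fix T
  have "{p \<in> Q. T \<le> Re p} \<subseteq> {p \<in> P. T \<le> Re p}" using assms(2) by auto
  then show "finite {p \<in> Q. T \<le> Re p}"
    using assms(1) unfolding left_discrete_def by (meson finite_subset)
qed

lemma left_discrete_locally_finite: "left_discrete P \<Longrightarrow> locally_finite_points P"
  unfolding locally_finite_points_def
proof
  fix B assume P: "left_discrete P"
  have "P \<inter> cball 0 B \<subseteq> {p \<in> P. - B \<le> Re p}"
  proof safe
    fix p :: complex assume "p \<in> cball 0 B"
    then show "- B \<le> Re p" using abs_Re_le_cmod[of p] by simp
  qed
  then show "finite (P \<inter> cball 0 B)" using P by (auto simp: left_discrete_def intro: finite_subset)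
qed

lemma left_discrete_Un: "left_discrete P \<Longrightarrow> left_discrete Q \<Longrightarrow> left_discrete (P \<union> Q)"
  unfolding left_discrete_def by (auto simp: conj_disj_distribR Collect_disj_eq)

lemma left_discrete_countable: "left_discrete P \<Longrightarrow> countable P"
  by (intro locally_finite_points_countable left_discrete_locally_finite)

lemma left_discrete_closed: "left_discrete P \<Longrightarrow> closed P"
  by (intro locally_finite_points_closed left_discrete_locally_finite)

section \<open>Functions that contract to the left\<close>

text \<open>
  A substitute for the asymptotics of the Gamma function that the recurrence alone provides. Iterated,
  it gives geometric decay under unit shifts to the left, uniformly on horizontal rays and vertical
  segments.
\<close>

definition left_contracting :: "real \<Rightarrow> real \<Rightarrow> (complex \<Rightarrow> complex) \<Rightarrow> bool" where
  "left_contracting q R h \<longleftrightarrow>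
     0 < q \<and> q < 1 \<and> (\<forall>s. Re s \<le> R \<longrightarrow> norm (h (s - 1)) \<le> q * norm (h s))"

lemma left_contracting_iterate:
  assumes "left_contracting q R h" and "Re s \<le> R"
  shows "norm (h (s - of_nat k)) \<le> q ^ k * norm (h s)"
proof (induction k)
  case (Suc k)
  have "norm (h (s - of_nat k - 1)) \<le> q * norm (h (s - of_nat k))"
    using assms unfolding left_contracting_def by auto
  also have "\<dots> \<le> q * (q ^ k * norm (h s))"
    using Suc assms unfolding left_contracting_def by (intro mult_left_mono) auto
  finally show ?case by (simp add: algebra_simps)
qed auto

lemma horizontal_segment:
  assumes "T \<le> T'"
  shows "closed_segment (Complex T y) (Complex T' y) = {s. Im s = y \<and> T \<le> Re s \<and> Re s \<le> T'}"
  using assms by (auto simp: closed_segment_same_Im closed_segment_eq_real_ivl)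

lemma left_contracting_ray_bound:
  assumes h: "left_contracting q R h" and B: "\<And>s. Im s = y \<Longrightarrow> R - 1 \<le> Re s \<Longrightarrow> Re s \<le> R \<Longrightarrow> norm (h s) \<le> B"
    and s: "Im s = y" "Re s \<le> R - real k"
  shows "norm (h s) \<le> q ^ k * B"
proof -
  define j where "j = nat \<lfloor>R - Re s\<rfloor>"
  have j: "real j \<le> R - Re s" "R - Re s < real j + 1"
    using s(2) unfolding j_def by (auto simp: le_nat_floor)
  have q: "0 < q" "q < 1" using h by (auto simp: left_contracting_def)
  have "k \<le> j" using s(2) j by linarith
  have Bj: "norm (h (s + of_nat j)) \<le> B"
    using s j by (intro B) auto
  have B0: "0 \<le> B" using Bj norm_ge_zero order_trans by blast
  have "norm (h (s + of_nat j - of_nat j)) \<le> q ^ j * norm (h (s + of_nat j))"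
    using j by (intro left_contracting_iterate[OF h]) auto
  also have "\<dots> \<le> q ^ j * B" using Bj q by (intro mult_left_mono) auto
  also have "\<dots> \<le> q ^ k * B"
    using \<open>k \<le> j\<close> q B0 by (intro mult_right_mono power_decreasing) auto
  finally show ?thesis by simp
qed

text \<open>
  Cut the ray into pieces of length one. A step to the left multiplies the bound on \<open>h\<close> by \<open>q\<close>, so
  the integrals over the pieces are dominated by a geometric series.
\<close>

lemma ray_integral_bound:
  assumes h: "left_contracting q R h" and "T0 \<le> R"
    and B: "\<And>s. Im s = y \<Longrightarrow> Re s \<le> T0 \<Longrightarrow> norm (h s) \<le> B"
    and cont: "continuous_on {s. Im s = y \<and> Re s \<le> T0} h" and "T \<le> T0"
  shows "norm (contour_integral (linepath (Complex T y) (Complex T0 y)) h) \<le> B / (1 - q)"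
proof -
  have q: "0 < q" "q < 1" using h by (auto simp: left_contracting_def)
  have "norm (contour_integral (linepath (Complex T y) (Complex T0 y)) h) \<le> B / (1 - q)"
    if "T0 - real N \<le> T" for N
    using that assms(2-)
  proof (induction N arbitrary: T0 B)
    case 0
    have "0 \<le> B" by (rule order_trans[OF norm_ge_zero "0.prems"(3)[of "Complex T0 y"]]) auto
    moreover have "T0 = T" using 0 by simp
    then have "contour_integral (linepath (Complex T y) (Complex T0 y)) h = 0"
      using contour_integral_trivial by blast
    ultimately show ?case using q by simp
  next
    case (Suc N)
    have B0: "0 \<le> B" by (rule order_trans[OF norm_ge_zero Suc.prems(3)[of "Complex T0 y"]]) auto
    have int: "h contour_integrable_on linepath (Complex t y) (Complex u y)" if "t \<le> u" "u \<le> T0" for t u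
      using that by (intro contour_integrable_continuous_linepath continuous_on_subset[OF Suc.prems(4)])
         (auto simp: horizontal_segment)
    have short: "norm (contour_integral (linepath (Complex t y) (Complex T0 y)) h) \<le> B"
      if "t \<le> T0" "T0 \<le> t + 1" for t
    proof -
      have "norm (contour_integral (linepath (Complex t y) (Complex T0 y)) h)
          \<le> B * norm (Complex T0 y - Complex t y)"
        using that B0 Suc.prems(3) by (intro contour_integral_bound_linepath int) (auto simp: horizontal_segment)
      also have "norm (Complex T0 y - Complex t y) = T0 - t"
        using that by (simp add: cmod_def)
      also have "B * (T0 - t) \<le> B * 1" using that B0 by (intro mult_left_mono) auto
      finally show ?thesis by simp
    qed
    have le: "B \<le> B / (1 - q)" using B0 q by (simp add: field_simps)
    show ?case
    proof (cases "T0 - 1 \<le> T")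
      case True
      then show ?thesis using short[of T] Suc.prems(5) le by simp
    next
      case False
      have "contour_integral (linepath (Complex T y) (Complex T0 y)) h =
        contour_integral (linepath (Complex T y) (Complex (T0 - 1) y)) h +
        contour_integral (linepath (Complex (T0 - 1) y) (Complex T0 y)) h"
        using False Suc.prems(5)
        by (intro contour_integral_split_linepath continuous_on_subset[OF Suc.prems(4)])
           (auto simp: horizontal_segment)
      also have "norm \<dots> \<le> (q * B) / (1 - q) + B"
      proof (intro norm_triangle_le add_mono short Suc.IH)
        show "norm (h s) \<le> q * B" if "Im s = y" "Re s \<le> T0 - 1" for s
        proof -
          have "Re (s + 1) \<le> R" using that Suc.prems(2) by simp
          then have "norm (h (s + 1 - 1)) \<le> q * norm (h (s + 1))"
            using h unfolding left_contracting_def by blast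
          also have "\<dots> \<le> q * B" using that q Suc.prems(3)[of "s + 1"] by (intro mult_left_mono) auto
          finally show ?thesis by simp
        qed
        show "continuous_on {s. Im s = y \<and> Re s \<le> T0 - 1} h"
          by (rule continuous_on_subset[OF Suc.prems(4)]) auto
      qed (use False Suc.prems in auto)
      also have "\<dots> = B / (1 - q)" using q by (simp add: field_simps)
      finally show ?thesis .
    qed
  qed
  moreover obtain N :: nat where "T0 - T \<le> real N" using real_arch_simple by blast
  then have "T0 - real N \<le> T" by simp
  ultimately show ?thesis by blast
qed

text \<open>
  Cauchy's criterion, for the limits that define integrals along left loops.
\<close>

lemma tendsto_at_bot_Cauchy:
  fixes f :: "real \<Rightarrow> complex"
  assumes "\<And>e. 0 < e \<Longrightarrow> \<exists>X. \<forall>T T'. T \<le> T' \<longrightarrow> T' \<le> X \<longrightarrow> dist (f T) (f T') < e"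
  shows "\<exists>v. (f \<longlongrightarrow> v) at_bot"
proof -
  have "Cauchy (\<lambda>k. f (- real k))"
  proof (rule metric_CauchyI)
    fix e :: real assume "0 < e"
    obtain X where X: "\<And>T T'. T \<le> T' \<Longrightarrow> T' \<le> X \<Longrightarrow> dist (f T) (f T') < e"
      using assms[OF \<open>0 < e\<close>] by blast
    obtain N :: nat where "- X \<le> real N" using real_arch_simple by blast
    then have "dist (f (- real i)) (f (- real j)) < e" if "N \<le> i" "N \<le> j" for i j
      using X[of "- real i" "- real j"] X[of "- real j" "- real i"] that
      by (cases "i \<le> j") (auto simp: dist_commute)
    then show "\<exists>N. \<forall>i\<ge>N. \<forall>j\<ge>N. dist (f (- real i)) (f (- real j)) < e" by blast
  qed
  then obtain v where v: "(\<lambda>k. f (- real k)) \<longlonglongrightarrow> v"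
    using Cauchy_convergent_iff convergent_def by blast
  have "\<forall>\<^sub>F T in at_bot. dist (f T) v < e" if "0 < e" for e
  proof -
    obtain X where X: "\<And>T T'. T \<le> T' \<Longrightarrow> T' \<le> X \<Longrightarrow> dist (f T) (f T') < e / 2"
      using assms[OF half_gt_zero[OF \<open>0 < e\<close>]] by blast
    have "dist (f T) v < e" if "T \<le> X" for T
    proof -
      have "\<forall>\<^sub>F k in sequentially. dist (f (- real k)) v < e / 2"
        using tendstoD[OF v, of "e / 2"] \<open>0 < e\<close> by simp
      moreover have "\<forall>\<^sub>F k in sequentially. - real k \<le> T"
        by real_asymp
      ultimately have "\<forall>\<^sub>F k in sequentially. dist (f (- real k)) v < e / 2 \<and> - real k \<le> T"
        by (rule eventually_conj)
      then obtain k where "dist (f (- real k)) v < e / 2" "- real k \<le> T"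
        using eventually_happens'[OF sequentially_bot] by blast
      then show ?thesis
        using X[of "- real k" T] that dist_triangle2[of "f T" v "f (- real k)"]
        by (metis dist_commute dist_triangle_half_l)
    qed
    then show ?thesis unfolding eventually_at_bot_linorder by blast
  qed
  then show ?thesis by (auto simp: tendsto_iff)
qed

section \<open>Cutting off left loops\<close>

text \<open>
  Only a cut-off at or below this abscissa makes the two connecting segments run in the direction of
  the rays of the loop.
\<close>

definition ray_top :: "(real \<Rightarrow> complex) \<Rightarrow> real" where
  "ray_top g = min (Re (pathstart g)) (Re (pathfinish g))"

lemma path_image_loop_cutoff:
  "path_image (loop_cutoff g T) =
     closed_segment (Complex T (Im (pathstart g))) (pathstart g) \<union> path_image g \<union>
     closed_segment (pathfinish g) (Complex T (Im (pathfinish g)))"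
  by (simp add: loop_cutoff_def path_image_join Un_assoc)

lemma path_image_closed_loop_cutoff:
  "path_image (closed_loop_cutoff g T) = path_image (loop_cutoff g T) \<union>
     closed_segment (Complex T (Im (pathfinish g))) (Complex T (Im (pathstart g)))"
  by (simp add: closed_loop_cutoff_def path_image_join loop_cutoff_def)

lemma path_image_loop_cutoff':
  assumes "T \<le> ray_top g"
  shows "path_image (loop_cutoff g T) = path_image g \<union>
     {s. Im s = Im (pathstart g) \<and> T \<le> Re s \<and> Re s \<le> Re (pathstart g)} \<union>
     {s. Im s = Im (pathfinish g) \<and> T \<le> Re s \<and> Re s \<le> Re (pathfinish g)}"
proof -
  have "closed_segment (Complex T (Im (pathstart g))) (pathstart g) =
     {s. Im s = Im (pathstart g) \<and> T \<le> Re s \<and> Re s \<le> Re (pathstart g)}"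
    using horizontal_segment[of T "Re (pathstart g)" "Im (pathstart g)"] assms
    by (simp add: ray_top_def)
  moreover have "closed_segment (pathfinish g) (Complex T (Im (pathfinish g))) =
     {s. Im s = Im (pathfinish g) \<and> T \<le> Re s \<and> Re s \<le> Re (pathfinish g)}"
    using horizontal_segment[of T "Re (pathfinish g)" "Im (pathfinish g)"] assms
    by (simp add: ray_top_def closed_segment_commute)
  ultimately show ?thesis by (auto simp: path_image_loop_cutoff)
qed

lemma path_image_loop_cutoff_mono:
  assumes "T' \<le> T" "T \<le> ray_top g"
  shows "path_image (loop_cutoff g T) \<subseteq> path_image (loop_cutoff g T')"
  using assms by (auto simp: path_image_loop_cutoff')

lemma valid_path_loop_cutoff:
  "valid_path g \<Longrightarrow> valid_path (loop_cutoff g T)"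
  by (auto simp: loop_cutoff_def intro!: valid_path_join)

lemma valid_path_closed_loop_cutoff:
  "valid_path g \<Longrightarrow> valid_path (closed_loop_cutoff g T)"
  unfolding closed_loop_cutoff_def
  by (intro valid_path_join valid_path_loop_cutoff) (auto simp: loop_cutoff_def)

lemma pathfinish_closed_loop_cutoff:
  "pathfinish (closed_loop_cutoff g T) = pathstart (closed_loop_cutoff g T)"
  by (simp add: closed_loop_cutoff_def loop_cutoff_def)

lemma contour_integral_loop_cutoff:
  assumes "valid_path g" "open S" "f holomorphic_on S" "path_image (loop_cutoff g T) \<subseteq> S"
  shows "contour_integral (loop_cutoff g T) f =
      contour_integral (linepath (Complex T (Im (pathstart g))) (pathstart g)) f +
      contour_integral g f + contour_integral (linepath (pathfinish g) (Complex T (Im (pathfinish g)))) f"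
proof -
  let ?l = "linepath (Complex T (Im (pathstart g))) (pathstart g)"
  let ?u = "linepath (pathfinish g) (Complex T (Im (pathfinish g)))"
  have "f contour_integrable_on ?l" "f contour_integrable_on g" "f contour_integrable_on ?u"
    using assms(4) unfolding path_image_loop_cutoff
    by (auto intro!: contour_integrable_holomorphic_simple[OF assms(3,2)] assms(1))
  then show ?thesis
    unfolding loop_cutoff_def using assms(1)
    by (simp add: valid_path_join)
qed

lemma contour_integral_closed_loop_cutoff:
  assumes "valid_path g" "open S" "f holomorphic_on S" "path_image (closed_loop_cutoff g T) \<subseteq> S"
  shows "contour_integral (closed_loop_cutoff g T) f = contour_integral (loop_cutoff g T) f +
     contour_integral (linepath (Complex T (Im (pathfinish g))) (Complex T (Im (pathstart g)))) f"
  unfolding closed_loop_cutoff_def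
  using assms(4) unfolding path_image_closed_loop_cutoff
  by (intro contour_integral_join contour_integrable_holomorphic_simple[OF assms(3,2)]
      valid_path_loop_cutoff assms(1)) auto

lemma contour_integral_loop_cutoff_split:
  assumes g: "valid_path g" "open S" "f holomorphic_on S" "path_image (loop_cutoff g T') \<subseteq> S"
    and T: "T' \<le> T" "T \<le> ray_top g"
  shows "contour_integral (loop_cutoff g T') f = contour_integral (loop_cutoff g T) f +
      contour_integral (linepath (Complex T' (Im (pathstart g))) (Complex T (Im (pathstart g)))) f -
      contour_integral (linepath (Complex T' (Im (pathfinish g))) (Complex T (Im (pathfinish g)))) f"
proof -
  let ?s = "pathstart g" and ?e = "pathfinish g"
  have im: "path_image (loop_cutoff g T) \<subseteq> S"
    using path_image_loop_cutoff_mono[OF T] g(4) by blast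
  have cont: "continuous_on A f" if "A \<subseteq> path_image (loop_cutoff g T')" for A
    using that g by (meson continuous_on_subset holomorphic_on_imp_continuous_on order_trans)
  have s: "closed_segment (Complex T' (Im ?s)) ?s = {z. Im z = Im ?s \<and> T' \<le> Re z \<and> Re z \<le> Re ?s}"
    using horizontal_segment[of T' "Re ?s" "Im ?s"] T by (simp add: ray_top_def)
  have e: "closed_segment (Complex T' (Im ?e)) ?e = {z. Im z = Im ?e \<and> T' \<le> Re z \<and> Re z \<le> Re ?e}"
    using horizontal_segment[of T' "Re ?e" "Im ?e"] T by (simp add: ray_top_def)
  have 1: "contour_integral (linepath (Complex T' (Im ?s)) ?s) f =
      contour_integral (linepath (Complex T' (Im ?s)) (Complex T (Im ?s))) f +
      contour_integral (linepath (Complex T (Im ?s)) ?s) f"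
    using T by (intro contour_integral_split_linepath cont)
      (auto simp: s path_image_loop_cutoff' ray_top_def)
  have 2: "contour_integral (linepath ?e (Complex T' (Im ?e))) f =
      contour_integral (linepath ?e (Complex T (Im ?e))) f +
      contour_integral (linepath (Complex T (Im ?e)) (Complex T' (Im ?e))) f"
    using T by (intro contour_integral_split_linepath cont; subst closed_segment_commute)
      (auto simp: e path_image_loop_cutoff' ray_top_def)
  have 3: "contour_integral (linepath (Complex T (Im ?e)) (Complex T' (Im ?e))) f =
      - contour_integral (linepath (Complex T' (Im ?e)) (Complex T (Im ?e))) f"
    using T by (intro contour_integral_reverse_linepath cont; subst closed_segment_commute)
      (auto simp: horizontal_segment path_image_loop_cutoff' ray_top_def)
  show ?thesis
    using contour_integral_loop_cutoff[OF g] contour_integral_loop_cutoff[OF g(1-3) im] 1 2 3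
    by (simp add: algebra_simps)
qed

section \<open>Winding numbers of cut-off loops\<close>

lemma rectangle_integral_eq_0:
  assumes "f holomorphic_on S" "convex S" "open S" "T' \<le> T"
    "{s. T' \<le> Re s \<and> Re s \<le> T} \<subseteq> S"
  shows "contour_integral (linepath (Complex T' y0) (Complex T y0)) f +
      contour_integral (linepath (Complex T y0) (Complex T y1)) f =
      contour_integral (linepath (Complex T' y1) (Complex T y1)) f +
      contour_integral (linepath (Complex T' y0) (Complex T' y1)) f"
proof -
  let ?a = "Complex T' y0" and ?b = "Complex T y0" and ?c = "Complex T y1" and ?d = "Complex T' y1"
  have seg: "closed_segment u v \<subseteq> S" if "u \<in> {?a, ?b, ?c, ?d}" "v \<in> {?a, ?b, ?c, ?d}" for u v
    using that assms(4,5) by (intro closed_segment_subset assms(2)) auto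
  have int: "f contour_integrable_on linepath u v" if "u \<in> {?a, ?b, ?c, ?d}" "v \<in> {?a, ?b, ?c, ?d}" for u v
    using seg[OF that] assms by (intro contour_integrable_holomorphic_simple[OF assms(1,3)]) auto
  have rev: "contour_integral (linepath u v) f = - contour_integral (linepath v u) f"
    if "u \<in> {?a, ?b, ?c, ?d}" "v \<in> {?a, ?b, ?c, ?d}" for u v
    using seg[OF that] assms(1)
    by (intro contour_integral_reverse_linepath) (meson continuous_on_subset holomorphic_on_imp_continuous_on)
  have "(f has_contour_integral 0) (linepath ?a ?b +++ linepath ?b ?c +++ linepath ?c ?d +++ linepath ?d ?a)"
    using seg by (intro Cauchy_theorem_convex_simple[OF assms(1,2)])
      (auto simp: path_image_join intro!: valid_path_join)
  then have "0 = contour_integral (linepath ?a ?b +++ linepath ?b ?c +++ linepath ?c ?d +++ linepath ?d ?a) f"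
    by (simp add: contour_integral_unique)
  also have "\<dots> = contour_integral (linepath ?a ?b) f + contour_integral (linepath ?b ?c) f +
      contour_integral (linepath ?c ?d) f + contour_integral (linepath ?d ?a) f"
    using int by (simp add: valid_path_join)
  finally show ?thesis using rev[of ?c ?d] rev[of ?d ?a] by (simp add: algebra_simps)
qed

lemma vertical_segment:
  "closed_segment (Complex T y) (Complex T y') \<subseteq> {s. Re s = T}"
  by (auto simp: closed_segment_same_Re)

text \<open>
  Lowering the cut-off changes the closed loop by the boundary of a rectangle that lies to the left of
  \<open>z\<close>. So a winding number that is known eventually is already attained at every cut-off below the
  loop and to the left of \<open>z\<close>, which is what the residue theorem at a fixed cut-off needs.
\<close>

lemma winding_number_closed_loop_cutoff_eq:
  assumes g: "valid_path g" and T: "T' \<le> T" "T \<le> ray_top g" and z: "T < Re z"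
    "z \<notin> path_image (loop_cutoff g T')"
  shows "winding_number (closed_loop_cutoff g T') z = winding_number (closed_loop_cutoff g T) z"
proof -
  let ?f = "\<lambda>w. 1 / (w - z)" and ?y0 = "Im (pathstart g)" and ?y1 = "Im (pathfinish g)"
  have S: "open (- {z})" "?f holomorphic_on - {z}"
    by (auto intro!: holomorphic_intros)
  have z': "z \<notin> path_image (loop_cutoff g T)"
    using path_image_loop_cutoff_mono[OF T] z(2) by blast
  have nz: "z \<notin> path_image (closed_loop_cutoff g t)" if "t = T \<or> t = T'" for t
    using that z' z T(1) subsetD[OF vertical_segment[of t], of z]
    unfolding path_image_closed_loop_cutoff by auto
  have "contour_integral (closed_loop_cutoff g T') ?f = contour_integral (closed_loop_cutoff g T) ?f"
  proof -
    have hol: "?f holomorphic_on {w. Re w < Re z}" by (auto intro!: holomorphic_intros)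
    have rev: "contour_integral (linepath (Complex t ?y1) (Complex t ?y0)) ?f =
        - contour_integral (linepath (Complex t ?y0) (Complex t ?y1)) ?f" if "t < Re z" for t
    proof (rule contour_integral_reverse_linepath)
      show "continuous_on (closed_segment (Complex t ?y1) (Complex t ?y0)) ?f"
        by (rule continuous_on_subset[OF holomorphic_on_imp_continuous_on[OF hol]])
          (use that vertical_segment[of t] in auto)
    qed
    have "contour_integral (linepath (Complex T' ?y0) (Complex T ?y0)) ?f +
      contour_integral (linepath (Complex T ?y0) (Complex T ?y1)) ?f =
      contour_integral (linepath (Complex T' ?y1) (Complex T ?y1)) ?f +
      contour_integral (linepath (Complex T' ?y0) (Complex T' ?y1)) ?f"
      using T z by (intro rectangle_integral_eq_0[OF hol] convex_halfspace_Re_lt open_halfspace_Re_lt) auto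
    moreover have "contour_integral (loop_cutoff g T') ?f = contour_integral (loop_cutoff g T) ?f +
      contour_integral (linepath (Complex T' ?y0) (Complex T ?y0)) ?f -
      contour_integral (linepath (Complex T' ?y1) (Complex T ?y1)) ?f"
      using z by (intro contour_integral_loop_cutoff_split[OF g S _ T]) auto
    moreover have "contour_integral (closed_loop_cutoff g t) ?f = contour_integral (loop_cutoff g t) ?f -
      contour_integral (linepath (Complex t ?y0) (Complex t ?y1)) ?f" if "t = T \<or> t = T'" for t
      using contour_integral_closed_loop_cutoff[OF g S, of t] nz[OF that] rev[of t] T z that by auto
    moreover have cancel: "L + B - U - W' = L - W" if "B + W = U + W'" for B U W W' L :: complex
    proof -
      have "B = U + W' - W" using that by (simp add: eq_diff_eq)
      then show ?thesis by simp
    qed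
    ultimately show ?thesis by simp
  qed
  then show ?thesis
    using nz by (simp add: winding_number_valid_path valid_path_closed_loop_cutoff g)
qed

text \<open>
  The cut-off loops grow when the cut-off is lowered, hence a point that is eventually avoided is
  avoided by all of them.
\<close>

lemma loop_cutoff_avoids:
  assumes "\<And>p. p \<in> P \<Longrightarrow> left_of_loop g p \<or> right_of_loop g p" and "T \<le> ray_top g"
  shows "path_image (loop_cutoff g T) \<inter> P = {}"
proof -
  have "p \<notin> path_image (loop_cutoff g T)" if "p \<in> P" for p
  proof -
    have "\<forall>\<^sub>F T in at_bot. p \<notin> path_image (closed_loop_cutoff g T)"
      using assms(1)[OF that] unfolding left_of_loop_def right_of_loop_def by (auto elim: eventually_mono)
    then have "\<forall>\<^sub>F T' in at_bot. p \<notin> path_image (closed_loop_cutoff g T') \<and> T' \<le> T"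
      by (intro eventually_conj eventually_le_at_bot)
    then obtain T' where "p \<notin> path_image (closed_loop_cutoff g T')" "T' \<le> T"
      using eventually_happens trivial_limit_at_bot_linorder by blast
    then show ?thesis
      using path_image_loop_cutoff_mono[of T' T g] assms(2) unfolding path_image_closed_loop_cutoff by blast
  qed
  then show ?thesis by blast
qed

lemma not_left_and_right: "left_of_loop g z \<Longrightarrow> right_of_loop g z \<Longrightarrow> False"
proof -
  assume "left_of_loop g z" "right_of_loop g z"
  then have "\<forall>\<^sub>F T in at_bot. winding_number (closed_loop_cutoff g T) z = 1 \<and>
      winding_number (closed_loop_cutoff g T) z = 0"
    unfolding right_of_loop_def left_of_loop_def by eventually_elim auto
  then show False using eventually_happens'[OF trivial_limit_at_bot_linorder] by fastforce
qed

lemma winding_number_left_of_loop: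
  assumes g: "valid_path g" and T: "T \<le> ray_top g" "T < Re z" and z: "left_of_loop g z"
  shows "winding_number (closed_loop_cutoff g T) z = 1"
proof -
  have "\<forall>\<^sub>F T' in at_bot. winding_number (closed_loop_cutoff g T') z = 1 \<and> T' \<le> T"
    using z unfolding left_of_loop_def by (intro eventually_conj eventually_le_at_bot) (auto elim: eventually_mono)
  then obtain T' where T': "winding_number (closed_loop_cutoff g T') z = 1" "T' \<le> T"
    using eventually_happens trivial_limit_at_bot_linorder by blast
  moreover have "z \<notin> path_image (loop_cutoff g T')"
    using loop_cutoff_avoids[of "{z}" g T'] z T T' by auto
  ultimately show ?thesis
    using winding_number_closed_loop_cutoff_eq[OF g] T by metis
qed

lemma winding_number_right_of_loop:
  assumes g: "valid_path g" and T: "T \<le> ray_top g" "T < Re z" and z: "right_of_loop g z"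
  shows "winding_number (closed_loop_cutoff g T) z = 0"
proof -
  have "\<forall>\<^sub>F T' in at_bot. winding_number (closed_loop_cutoff g T') z = 0 \<and> T' \<le> T"
    using z unfolding right_of_loop_def by (intro eventually_conj eventually_le_at_bot) (auto elim: eventually_mono)
  then obtain T' where T': "winding_number (closed_loop_cutoff g T') z = 0" "T' \<le> T"
    using eventually_happens trivial_limit_at_bot_linorder by blast
  moreover have "z \<notin> path_image (loop_cutoff g T')"
    using loop_cutoff_avoids[of "{z}" g T'] z T T' by auto
  ultimately show ?thesis
    using winding_number_closed_loop_cutoff_eq[OF g] T by metis
qed

text \<open>
  The residue theorem in the plane without the poles to the left of the cut-off. Each pole to the
  right of the cut-off has winding number 1 or 0, according to its side of the loop.
\<close>

lemma closed_loop_integral: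
  assumes g: "valid_path g" and P: "left_discrete P" and h: "h holomorphic_on - P"
    and sides: "\<And>p. p \<in> P \<Longrightarrow> left_of_loop g p \<or> right_of_loop g p"
    and Q: "Q = {p \<in> P. right_of_loop g p}" "\<And>p. p \<in> Q \<Longrightarrow> T < Re p"
    and T: "\<And>p. p \<in> P \<Longrightarrow> Re p \<noteq> T" "\<And>z. z \<in> path_image g \<Longrightarrow> T \<le> Re z"
  shows "contour_integral (closed_loop_cutoff g T) h =
     2 * pi * \<i> * ((\<Sum>p\<in>{p \<in> P. T \<le> Re p}. residue h p) - (\<Sum>p\<in>Q. residue h p))"
proof -
  let ?c = "closed_loop_cutoff g T"
  have top: "T \<le> ray_top g" using T(2) by (auto simp: ray_top_def)
  have fin: "finite {p \<in> P. T \<le> Re p}" using P by (simp add: left_discrete_def)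
  have avoid: "path_image ?c \<inter> P = {}"
    using loop_cutoff_avoids[OF sides top] T(1) vertical_segment[of T]
    unfolding path_image_closed_loop_cutoff by blast
  have right: "path_image ?c \<subseteq> {s. T \<le> Re s}"
    using T(2) vertical_segment[of T] path_image_loop_cutoff'[OF top]
    unfolding path_image_closed_loop_cutoff by auto
  define L where "L = {p \<in> P. Re p < T}"
  have L: "left_discrete L" by (rule left_discrete_subset[OF P]) (auto simp: L_def)
  have D: "- L - {p \<in> P. T \<le> Re p} = - P" using T(1) by (auto simp: L_def)
  have "contour_integral ?c h =
      2 * pi * \<i> * (\<Sum>p\<in>{p \<in> P. T \<le> Re p}. winding_number ?c p * residue h p)"
  proof (rule Residue_theorem[of "- L"])
    show "open (- L)" using left_discrete_closed[OF L] by auto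
    have "connected (UNIV - L)"
      by (rule connected_open_diff_countable) (auto simp: left_discrete_countable[OF L])
    then show "connected (- L)" by (simp add: Compl_eq_Diff_UNIV)
    show "\<forall>z. z \<notin> - L \<longrightarrow> winding_number ?c z = 0"
    proof (intro allI impI)
      fix z assume "z \<notin> - L"
      then have "z \<notin> {s. T \<le> Re s}" by (auto simp: L_def)
      then show "winding_number ?c z = 0"
        using right by (intro winding_number_zero_outside[of _ "{s. T \<le> Re s}"] convex_halfspace_Re_ge)
          (auto simp: valid_path_imp_path valid_path_closed_loop_cutoff g pathfinish_closed_loop_cutoff)
    qed
  qed (use fin h D avoid in \<open>auto simp: valid_path_closed_loop_cutoff g pathfinish_closed_loop_cutoff\<close>)
  also have "(\<Sum>p\<in>{p \<in> P. T \<le> Re p}. winding_number ?c p * residue h p) =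
      (\<Sum>p\<in>{p \<in> P. T \<le> Re p}. residue h p - (if p \<in> Q then residue h p else 0))"
  proof (rule sum.cong[OF refl])
    fix p assume p: "p \<in> {p \<in> P. T \<le> Re p}"
    then have "T < Re p" using T(1)[of p] by auto
    then show "winding_number ?c p * residue h p = residue h p - (if p \<in> Q then residue h p else 0)"
      using winding_number_right_of_loop[OF g top] winding_number_left_of_loop[OF g top] p sides[of p]
      by (cases "right_of_loop g p") (auto simp: Q(1))
  qed
  also have "\<dots> = (\<Sum>p\<in>{p \<in> P. T \<le> Re p}. residue h p) - (\<Sum>p\<in>Q. residue h p)"
  proof -
    have "Q = {p \<in> P. T \<le> Re p} \<inter> Q" using Q(2) by (force simp: Q(1))
    then have "(\<Sum>p\<in>Q. residue h p) = (\<Sum>p\<in>{p \<in> P. T \<le> Re p}. if p \<in> Q then residue h p else 0)"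
      using sum.inter_restrict[OF fin, of "residue h" Q] by simp
    then show ?thesis by (simp add: sum_subtractf)
  qed
  finally show ?thesis .
qed

section \<open>Integrals along left loops\<close>

lemma ray_bounded:
  assumes "continuous_on {s. Im s = y \<and> Re s \<le> R} h"
  shows "\<exists>B. \<forall>s. Im s = y \<longrightarrow> R - 1 \<le> Re s \<longrightarrow> Re s \<le> R \<longrightarrow> norm (h s) \<le> B"
proof -
  have "compact (h ` closed_segment (Complex (R - 1) y) (Complex R y))"
    by (intro compact_continuous_image compact_segment continuous_on_subset[OF assms])
      (auto simp: horizontal_segment)
  then obtain B where "\<forall>z\<in>h ` closed_segment (Complex (R - 1) y) (Complex R y). norm z \<le> B"
    using compact_imp_bounded bounded_iff by blast
  then show ?thesis by (intro exI[of _ B]) (auto simp: horizontal_segment)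
qed

lemma ray_subset_loop_cutoff:
  assumes "Re s \<le> ray_top g" "Im s = Im (pathstart g) \<or> Im s = Im (pathfinish g)"
  shows "s \<in> path_image (loop_cutoff g (Re s))"
  using assms by (subst path_image_loop_cutoff') (auto simp: ray_top_def)

text \<open>
  Two cut-off integrals differ by the integrals over two horizontal segments. The bound is uniform in
  everything that \<open>B\<close> and \<open>q\<close> are uniform in; it is used once for a single function and once for a
  holomorphic family.
\<close>

lemma loop_cutoff_integral_diff_bound:
  assumes g: "valid_path g" and h: "left_contracting q R h" "open S" "h holomorphic_on S"
    and avoid: "\<And>T. T \<le> ray_top g \<Longrightarrow> path_image (loop_cutoff g T) \<subseteq> S" and R: "R \<le> ray_top g"
    and B: "\<And>s. Im s = Im (pathstart g) \<or> Im s = Im (pathfinish g) \<Longrightarrow>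
        R - 1 \<le> Re s \<Longrightarrow> Re s \<le> R \<Longrightarrow> norm (h s) \<le> B"
    and T: "T \<le> T'" "T' \<le> R - real k"
  shows "norm (contour_integral (loop_cutoff g T) h - contour_integral (loop_cutoff g T') h)
      \<le> q ^ k * (2 * B / (1 - q))"
proof -
  let ?y0 = "Im (pathstart g)" and ?y1 = "Im (pathfinish g)"
  have *: "norm (contour_integral (linepath (Complex T y) (Complex T' y)) h) \<le> (q ^ k * B) / (1 - q)"
    if y: "y = ?y0 \<or> y = ?y1" for y
  proof (rule ray_integral_bound[OF h(1)])
    show "norm (h s) \<le> q ^ k * B" if "Im s = y" "Re s \<le> T'" for s
      using that T(2) y B by (intro left_contracting_ray_bound[OF h(1), of y]) auto
    show "continuous_on {s. Im s = y \<and> Re s \<le> T'} h"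
    proof (rule continuous_on_subset[OF holomorphic_on_imp_continuous_on[OF h(3)]], safe)
      fix s assume "Re s \<le> T'" "y = Im s"
      then show "s \<in> S" using ray_subset_loop_cutoff[of s g] avoid[of "Re s"] y R T by auto
    qed
  qed (use T in auto)
  have "contour_integral (loop_cutoff g T) h - contour_integral (loop_cutoff g T') h =
      contour_integral (linepath (Complex T ?y0) (Complex T' ?y0)) h -
      contour_integral (linepath (Complex T ?y1) (Complex T' ?y1)) h"
    using contour_integral_loop_cutoff_split[OF g h(2,3) avoid, of T T'] T R by simp
  also have "norm \<dots> \<le> q ^ k * B / (1 - q) + q ^ k * B / (1 - q)"
    using * by (intro norm_triangle_le_diff add_mono) auto
  finally show ?thesis by (simp add: mult_ac)
qed

lemma loop_integral_exists:
  assumes g: "valid_path g" and h: "left_contracting q R h" "open S" "h holomorphic_on S"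
    and avoid: "\<And>T. T \<le> ray_top g \<Longrightarrow> path_image (loop_cutoff g T) \<subseteq> S"
  shows "\<exists>v. has_loop_integral h v g"
proof -
  let ?y0 = "Im (pathstart g)" and ?y1 = "Im (pathfinish g)"
  have q: "0 < q" "q < 1" using h(1) by (auto simp: left_contracting_def)
  define R' where "R' = min R (ray_top g)"
  have h': "left_contracting q R' h" using h(1) by (auto simp: left_contracting_def R'_def)
  have cont: "continuous_on {s. Im s = y \<and> Re s \<le> R'} h" if "y = ?y0 \<or> y = ?y1" for y
  proof (rule continuous_on_subset[OF holomorphic_on_imp_continuous_on[OF h(3)]], safe)
    fix s assume "Re s \<le> R'" "y = Im s"
    then show "s \<in> S" using ray_subset_loop_cutoff[of s g] avoid[of "Re s"] that by (auto simp: R'_def)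
  qed
  obtain B0 where B0: "\<And>s. Im s = ?y0 \<Longrightarrow> R' - 1 \<le> Re s \<Longrightarrow> Re s \<le> R' \<Longrightarrow> norm (h s) \<le> B0"
    using ray_bounded[OF cont[of ?y0]] by auto
  obtain B1 where B1: "\<And>s. Im s = ?y1 \<Longrightarrow> R' - 1 \<le> Re s \<Longrightarrow> Re s \<le> R' \<Longrightarrow> norm (h s) \<le> B1"
    using ray_bounded[OF cont[of ?y1]] by auto
  let ?B = "2 * max B0 B1 / (1 - q)"
  have diff: "norm (contour_integral (loop_cutoff g T) h - contour_integral (loop_cutoff g T') h)
      \<le> q ^ k * ?B" if T: "T \<le> T'" "T' \<le> R' - real k" for T T' k
    using that B0 B1
    by (intro loop_cutoff_integral_diff_bound[OF g h' h(2,3) avoid]) (auto simp: R'_def le_max_iff_disj)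
  have "\<exists>v. ((\<lambda>T. contour_integral (loop_cutoff g T) h) \<longlongrightarrow> v) at_bot"
  proof (rule tendsto_at_bot_Cauchy)
    fix e :: real assume "0 < e"
    have "(\<lambda>k. q ^ k * ?B) \<longlonglongrightarrow> 0"
      using q by (intro tendsto_mult_left_zero LIMSEQ_realpow_zero) auto
    then have "\<forall>\<^sub>F k in sequentially. q ^ k * ?B < e"
      using \<open>0 < e\<close> by (rule order_tendstoD)
    then obtain k where "q ^ k * ?B < e"
      using eventually_happens'[OF sequentially_bot] by blast
    then show "\<exists>X. \<forall>T T'. T \<le> T' \<longrightarrow> T' \<le> X \<longrightarrow>
        dist (contour_integral (loop_cutoff g T) h) (contour_integral (loop_cutoff g T') h) < e"
      using diff by (intro exI[of _ "R' - real k"]) (auto simp: dist_norm intro: order_le_less_trans)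
  qed
  moreover have "\<forall>\<^sub>F T in at_bot. h contour_integrable_on loop_cutoff g T"
    using eventually_le_at_bot[of "ray_top g"]
    by eventually_elim (intro contour_integrable_holomorphic_simple[OF h(3,2)] valid_path_loop_cutoff g avoid)
  ultimately show ?thesis by (auto simp: has_loop_integral_def)
qed

text \<open>
  The segments are the integer translates of one compact segment, so contraction applies pointwise and
  no estimate of \<open>h\<close> close to its poles is needed.
\<close>

lemma vertical_integrals_tendsto_0:
  assumes h: "left_contracting q R h" and "T \<le> R"
    and "continuous_on (closed_segment (Complex T y) (Complex T y')) h"
    and int: "\<And>k. h contour_integrable_on linepath (Complex (T - real k) y) (Complex (T - real k) y')"
  shows "(\<lambda>k. contour_integral (linepath (Complex (T - real k) y) (Complex (T - real k) y')) h) \<longlonglongrightarrow> 0"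
proof -
  have q: "0 < q" "q < 1" using h(1) by (auto simp: left_contracting_def)
  have "compact (h ` closed_segment (Complex T y) (Complex T y'))"
    by (intro compact_continuous_image assms(3)) auto
  then obtain B where "\<forall>z\<in>h ` closed_segment (Complex T y) (Complex T y'). norm z \<le> B"
    using compact_imp_bounded bounded_iff by blast
  then have B: "norm (h s) \<le> B" if "s \<in> closed_segment (Complex T y) (Complex T y')" for s
    using that by blast
  have B0: "0 \<le> B" by (rule order_trans[OF norm_ge_zero B[of "Complex T y"]]) simp
  have "norm (contour_integral (linepath (Complex (T - real k) y) (Complex (T - real k) y')) h)
      \<le> q ^ k * (B * \<bar>y' - y\<bar>)" for k
  proof -
    have "norm (contour_integral (linepath (Complex (T - real k) y) (Complex (T - real k) y')) h)
      \<le> (q ^ k * B) * norm (Complex (T - real k) y' - Complex (T - real k) y)"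
    proof (intro contour_integral_bound_linepath int)
      fix s assume "s \<in> closed_segment (Complex (T - real k) y) (Complex (T - real k) y')"
      then have s: "s + of_nat k \<in> closed_segment (Complex T y) (Complex T y')"
        by (simp add: closed_segment_same_Re)
      have "Re (s + of_nat k) = T" using s vertical_segment by blast
      then have "norm (h (s + of_nat k - of_nat k)) \<le> q ^ k * norm (h (s + of_nat k))"
        using assms(2) by (intro left_contracting_iterate[OF h]) auto
      also have "\<dots> \<le> q ^ k * B" using B[OF s] q by (intro mult_left_mono) auto
      finally show "norm (h s) \<le> q ^ k * B" by simp
    qed (use q B0 in auto)
    also have "norm (Complex (T - real k) y' - Complex (T - real k) y) = \<bar>y' - y\<bar>"
      by (simp add: cmod_def)
    finally show ?thesis by (simp add: mult_ac)
  qed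
  moreover have "(\<lambda>k. q ^ k * (B * \<bar>y' - y\<bar>)) \<longlonglongrightarrow> 0"
    using q by (intro tendsto_mult_left_zero LIMSEQ_realpow_zero) auto
  ultimately show ?thesis by (rule Lim_null_comparison[OF always_eventually[OF allI]])
qed

text \<open>
  Supplies the cut-offs \<open>T - k\<close> for which no vertical line passes through a pole.
\<close>

lemma countable_avoiding_translates:
  assumes "countable (A :: real set)"
  shows "\<exists>T\<le>X. \<forall>k::nat. T - real k \<notin> A"
proof -
  have "countable (\<Union>k::nat. (\<lambda>x. x + real k) ` A)" using assms by auto
  moreover have "uncountable {..X}"
    using uncountable_closed_interval[of "X - 1" X] countable_subset[of "{X - 1..X}" "{..X}"] by auto
  ultimately obtain T where "T \<le> X" "T \<notin> (\<Union>k::nat. (\<lambda>x. x + real k) ` A)"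
    by (meson atMost_iff countable_subset subsetI)
  then have "T - real k \<notin> A" for k by force
  then show ?thesis using \<open>T \<le> X\<close> by blast
qed

text \<open>
  At the cut-offs \<open>T0 - k\<close> the two closed loops enclose the same poles except those in \<open>Q\<close>, so their
  integrals differ by a sum of residues that does not depend on \<open>k\<close>. The vertical sides vanish in the
  limit.
\<close>

lemma loop_integral_compare:
  assumes P: "left_discrete P" and h: "h holomorphic_on - P" "left_contracting q R h"
    and g: "valid_path g" "valid_path g'"
    and sides: "\<And>p. p \<in> P \<Longrightarrow> left_of_loop g p \<or> right_of_loop g p"
       "\<And>p. p \<in> P \<Longrightarrow> left_of_loop g' p"
    and Q: "Q = {p \<in> P. right_of_loop g p}" "finite Q"
    and v: "has_loop_integral h v g" "has_loop_integral h v' g'"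
  shows "v = v' - 2 * pi * \<i> * (\<Sum>p\<in>Q. residue h p)"
proof -
  have Q': "{p \<in> P. right_of_loop g' p} = {}"
    using sides(2) not_left_and_right by blast
  have closedP: "open (- P)" using left_discrete_closed[OF P] by auto
  have "bounded (path_image g \<union> path_image g' \<union> Q)"
    using g Q(2) by (simp add: bounded_path_image valid_path_imp_path finite_imp_bounded)
  then obtain X where "\<forall>z \<in> path_image g \<union> path_image g' \<union> Q. norm z \<le> X"
    unfolding bounded_iff by blast
  then have X: "norm z \<le> X" if "z \<in> path_image g \<union> path_image g' \<union> Q" for z
    using that by blast
  have "countable (Re ` P)" using left_discrete_countable[OF P] by blast
  \<comment> \<open>Start left of the disc of radius \<open>X\<close>, which contains both bounded parts and \<open>Q\<close>.\<close>
  then obtain T0 where T0: "T0 \<le> min R (- X - 1)" "\<forall>k::nat. T0 - real k \<notin> Re ` P"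
    using countable_avoiding_translates by blast
  define T where "T k = T0 - real k" for k :: nat
  have T_less: "T k < Re z" if "z \<in> path_image g \<union> path_image g' \<union> Q" for z k
    using X[OF that] abs_Re_le_cmod[of z] T0(1) unfolding T_def by linarith
  have top: "T k \<le> ray_top g" "T k \<le> ray_top g'" for k
    unfolding ray_top_def by (auto intro!: less_imp_le T_less)
  have noP: "Re p \<noteq> T k" if "p \<in> P" for p k
    using T0(2) that unfolding T_def by (metis image_eqI)
  have vseg: "closed_segment (Complex (T k) y) (Complex (T k) y') \<subseteq> - P" for k y y'
    using vertical_segment[of "T k" y y'] noP by auto
  have vert: "(\<lambda>k. contour_integral (linepath (Complex (T k) y) (Complex (T k) y')) h) \<longlonglongrightarrow> 0" for y y'
    unfolding T_def
  proof (rule vertical_integrals_tendsto_0[OF h(2)])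
    show "T0 \<le> R" using T0 by simp
    show "continuous_on (closed_segment (Complex T0 y) (Complex T0 y')) h"
      using vseg[of 0] by (intro continuous_on_subset[OF holomorphic_on_imp_continuous_on[OF h(1)]]) (simp add: T_def)
    show "h contour_integrable_on linepath (Complex (T0 - real k) y) (Complex (T0 - real k) y')" for k
      using vseg[of k] by (intro contour_integrable_holomorphic_simple[OF h(1) closedP]) (auto simp: T_def)
  qed
  have T_lim: "filterlim T at_bot sequentially"
    unfolding T_def by real_asymp
  have lim: "(\<lambda>k. contour_integral (closed_loop_cutoff f (T k)) h) \<longlonglongrightarrow> w"
    if f: "valid_path f" "\<And>k. T k \<le> ray_top f" "has_loop_integral h w f"
      "\<And>p. p \<in> P \<Longrightarrow> left_of_loop f p \<or> right_of_loop f p" for f w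
  proof -
    have "(\<lambda>k. contour_integral (loop_cutoff f (T k)) h) \<longlonglongrightarrow> w"
      using f(3) T_lim unfolding has_loop_integral_def by (auto intro: filterlim_compose)
    moreover have "contour_integral (closed_loop_cutoff f (T k)) h = contour_integral (loop_cutoff f (T k)) h +
        contour_integral (linepath (Complex (T k) (Im (pathfinish f))) (Complex (T k) (Im (pathstart f)))) h" for k
    proof (rule contour_integral_closed_loop_cutoff[OF f(1) closedP h(1)])
      show "path_image (closed_loop_cutoff f (T k)) \<subseteq> - P"
        using loop_cutoff_avoids[OF f(4,2)] vseg unfolding path_image_closed_loop_cutoff by blast
    qed
    ultimately show ?thesis
      using tendsto_add[OF _ vert] by fastforce
  qed
  have eq: "contour_integral (closed_loop_cutoff g (T k)) h =
     contour_integral (closed_loop_cutoff g' (T k)) h - 2 * pi * \<i> * (\<Sum>p\<in>Q. residue h p)" for k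
  proof -
    have le: "T k \<le> Re z" if "z \<in> path_image g \<union> path_image g'" for z
      using T_less that by (auto intro: less_imp_le)
    show ?thesis
      using closed_loop_integral[OF g(1) P h(1) sides(1) Q(1), of "T k"]
        closed_loop_integral[OF g(2) P h(1) _ Q'[symmetric], of "T k"] sides(2) T_less noP le
      by (simp add: algebra_simps)
  qed
  have "(\<lambda>k. contour_integral (closed_loop_cutoff g (T k)) h) \<longlonglongrightarrow> v' - 2 * pi * \<i> * (\<Sum>p\<in>Q. residue h p)"
    unfolding eq by (intro tendsto_diff lim[OF g(2) top(2) v(2)] tendsto_const) (simp add: sides(2))
  then show ?thesis
    using LIMSEQ_unique lim[OF g(1) top(1) v(1) sides(1)] by blast
qed

section \<open>Loops that separate two sets of points\<close>

text \<open>
  Walk to a small circle around \<open>q\<close> on a path that avoids \<open>D\<close>, go round it clockwise, and walk back.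
  The outward and the return walk cancel in every winding number.
\<close>

lemma clockwise_loop:
  assumes D: "locally_finite_points D" and "q \<in> D" "z0 \<notin> D"
  shows "\<exists>\<gamma>. valid_path \<gamma> \<and> pathstart \<gamma> = z0 \<and> pathfinish \<gamma> = z0 \<and> path_image \<gamma> \<inter> D = {} \<and>
    (\<forall>d\<in>D. winding_number \<gamma> d = (if d = q then - 1 else 0))"
proof -
  obtain e where e: "e > 0" "cball q e \<inter> D \<subseteq> {q}"
    using locally_finite_points_isolated[OF D] by blast
  let ?c = "circlepath q e"
  have c: "path_image ?c \<inter> D = {}" using e by auto
  have "connected (UNIV - D)"
    by (rule connected_open_diff_countable) (auto simp: locally_finite_points_countable[OF D])
  then have "connected (- D)" by (simp add: Compl_eq_Diff_UNIV)
  moreover have "open (- D)" using locally_finite_points_closed[OF D] by auto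
  moreover have "pathstart ?c \<in> - D" using c pathstart_in_path_image by blast
  ultimately obtain \<pi> where \<pi>: "polynomial_function \<pi>" "path_image \<pi> \<subseteq> - D"
      "pathstart \<pi> = z0" "pathfinish \<pi> = pathstart ?c"
    using connected_open_polynomial_connected[of "- D" z0 "pathstart ?c"] assms by auto
  let ?\<gamma> = "\<pi> +++ reversepath ?c +++ reversepath \<pi>"
  have vp: "valid_path \<pi>" using \<pi> by (simp add: valid_path_polynomial_function)
  have fin: "pathfinish ?c = pathstart ?c" by simp
  have wind: "winding_number ?\<gamma> d = - winding_number ?c d" if "d \<in> D" for d
  proof -
    have d: "d \<notin> path_image \<pi>" "d \<notin> path_image ?c" using that \<pi> c by auto
    have p: "path \<pi>" "path ?c" using vp by (auto simp: valid_path_imp_path)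
    have "winding_number ?\<gamma> d = winding_number \<pi> d + winding_number (reversepath ?c +++ reversepath \<pi>) d"
      using d p \<pi>(4) fin by (intro winding_number_join) (auto simp: path_image_join)
    also have "winding_number (reversepath ?c +++ reversepath \<pi>) d = winding_number (reversepath ?c) d + winding_number (reversepath \<pi>) d"
      using d p \<pi>(4) by (intro winding_number_join) auto
    finally show ?thesis using d p by (simp add: winding_number_reversepath)
  qed
  have "winding_number ?c d = (if d = q then 1 else 0)" if "d \<in> D" for d
  proof (cases "d = q")
    case False
    then have "d \<notin> cball q e" using e that by auto
    then have "winding_number ?c d = 0"
      by (intro winding_number_zero_outside[of _ "cball q e"]) (use e in auto)
    then show ?thesis using False by simp
  qed (use e in \<open>simp add: winding_number_circlepath_centre\<close>)
  then have "\<forall>d\<in>D. winding_number ?\<gamma> d = (if d = q then - 1 else 0)" using wind by auto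
  moreover have "valid_path ?\<gamma>" "pathstart ?\<gamma> = z0" "pathfinish ?\<gamma> = z0"
    using vp \<pi> fin by (auto intro!: valid_path_join)
  moreover have "path_image ?\<gamma> \<inter> D = {}"
    using \<pi> c fin by (auto simp: path_image_join)
  ultimately show ?thesis by blast
qed

lemma clockwise_loops:
  assumes D: "locally_finite_points D" and "finite Q" "Q \<subseteq> D" "z0 \<notin> D"
  shows "\<exists>\<gamma>. valid_path \<gamma> \<and> pathstart \<gamma> = z0 \<and> pathfinish \<gamma> = z0 \<and> path_image \<gamma> \<inter> D = {} \<and>
    (\<forall>d\<in>D. winding_number \<gamma> d = (if d \<in> Q then - 1 else 0))"
  using assms(2,3)
proof (induction Q rule: finite_induct)
  case empty
  have "winding_number (linepath z0 z0) d = 0" if "d \<in> D" for d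
    using that assms(4) by (intro winding_number_zero_outside[of _ "{z0}"]) auto
  moreover have "path_image (linepath z0 z0) \<inter> D = {}"
    using assms(4) by (subst path_image_linepath) simp
  ultimately show ?case
    using valid_path_linepath pathstart_linepath pathfinish_linepath by (metis empty_iff)
next
  case (insert q Q)
  obtain \<gamma> where \<gamma>: "valid_path \<gamma>" "pathstart \<gamma> = z0" "pathfinish \<gamma> = z0" "path_image \<gamma> \<inter> D = {}"
      "\<forall>d\<in>D. winding_number \<gamma> d = (if d \<in> Q then - 1 else 0)"
    using insert by auto
  obtain \<delta> where \<delta>: "valid_path \<delta>" "pathstart \<delta> = z0" "pathfinish \<delta> = z0" "path_image \<delta> \<inter> D = {}"
      "\<forall>d\<in>D. winding_number \<delta> d = (if d = q then - 1 else 0)"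
    using clockwise_loop[OF D, of q z0] insert assms(4) by auto
  have "winding_number (\<gamma> +++ \<delta>) d = (if d \<in> insert q Q then - 1 else 0)" if "d \<in> D" for d
  proof -
    have "winding_number (\<gamma> +++ \<delta>) d = winding_number \<gamma> d + winding_number \<delta> d"
      using \<gamma> \<delta> that by (intro winding_number_join) (auto simp: valid_path_imp_path)
    then show ?thesis using \<gamma>(5) \<delta>(5) that insert.hyps by auto
  qed
  then show ?case
    using \<gamma> \<delta> by (intro exI[of _ "\<gamma> +++ \<delta>"]) (auto simp: path_image_join intro!: valid_path_join)
qed

lemma winding_number_closed_loop_cutoff:
  assumes "valid_path g" "z \<notin> path_image (closed_loop_cutoff g T)"
  shows "winding_number (closed_loop_cutoff g T) z =
    winding_number (linepath (Complex T (Im (pathstart g))) (pathstart g)) z + winding_number g z +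
    winding_number (linepath (pathfinish g) (Complex T (Im (pathfinish g)))) z +
    winding_number (linepath (Complex T (Im (pathfinish g))) (Complex T (Im (pathstart g)))) z"
proof -
  have z: "z \<notin> path_image (loop_cutoff g T)"
      "z \<notin> closed_segment (Complex T (Im (pathfinish g))) (Complex T (Im (pathstart g)))"
    using assms(2) by (auto simp: path_image_closed_loop_cutoff)
  have p: "path g" "path (loop_cutoff g T)"
    using assms(1) by (auto intro!: valid_path_imp_path valid_path_loop_cutoff)
  have "winding_number (closed_loop_cutoff g T) z = winding_number (loop_cutoff g T) z +
    winding_number (linepath (Complex T (Im (pathfinish g))) (Complex T (Im (pathstart g)))) z"
    unfolding closed_loop_cutoff_def using z p by (intro winding_number_join) (auto simp: loop_cutoff_def)
  also have "winding_number (loop_cutoff g T) z =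
    winding_number (linepath (Complex T (Im (pathstart g))) (pathstart g)) z +
    winding_number (g +++ linepath (pathfinish g) (Complex T (Im (pathfinish g)))) z"
    unfolding loop_cutoff_def using z p
    by (intro winding_number_join) (auto simp: path_image_loop_cutoff path_image_join)
  also have "winding_number (g +++ linepath (pathfinish g) (Complex T (Im (pathfinish g)))) z =
    winding_number g z + winding_number (linepath (pathfinish g) (Complex T (Im (pathfinish g)))) z"
    using z p by (intro winding_number_join) (auto simp: path_image_loop_cutoff)
  finally show ?thesis by simp
qed

abbreviation vertical_loop :: "real \<Rightarrow> real \<Rightarrow> real \<Rightarrow> complex" where
  "vertical_loop X H \<equiv> linepath (Complex X (- H)) (Complex X H)"

lemma path_image_closed_vertical_loop:
  assumes "T \<le> X" "0 \<le> H"
  shows "path_image (closed_loop_cutoff (vertical_loop X H) T) =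
    path_image (rectpath (Complex T (- H)) (Complex X H))"
  by (auto simp: path_image_closed_loop_cutoff path_image_loop_cutoff rectpath_def Let_def path_image_join)

lemma winding_number_vertical_loop:
  assumes "T < Re z" "Re z < X" "\<bar>Im z\<bar> < H"
  shows "z \<notin> path_image (closed_loop_cutoff (vertical_loop X H) T)"
    "winding_number (closed_loop_cutoff (vertical_loop X H) T) z = 1"
proof -
  let ?r = "rectpath (Complex T (- H)) (Complex X H)"
  have box: "z \<in> box (Complex T (- H)) (Complex X H)"
    using assms by (auto simp: in_box_complex_iff)
  then have z: "z \<notin> path_image ?r"
    using path_image_rectpath_inter_box[of "Complex T (- H)" "Complex X H"] assms by fastforce
  then show *: "z \<notin> path_image (closed_loop_cutoff (vertical_loop X H) T)"
    using assms by (subst path_image_closed_vertical_loop) auto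
  have "winding_number ?r z = 1" by (rule winding_number_rectpath[OF box])
  moreover have "winding_number ?r z = winding_number (closed_loop_cutoff (vertical_loop X H) T) z"
    using z unfolding winding_number_closed_loop_cutoff[OF valid_path_linepath *] rectpath_def Let_def
    by (simp add: winding_number_join path_image_join)
  ultimately show "winding_number (closed_loop_cutoff (vertical_loop X H) T) z = 1" by simp
qed

lemma left_of_vertical_loop:
  assumes "Re z < X" "\<bar>Im z\<bar> < H"
  shows "left_of_loop (vertical_loop X H) z"
  using eventually_gt_at_bot[of "Re z"] unfolding left_of_loop_def
  by eventually_elim (use winding_number_vertical_loop[OF _ assms] in auto)

lemma winding_number_vertical_loop_outside:
  assumes "X < Re z" "T \<le> X"
  shows "z \<notin> path_image (closed_loop_cutoff (vertical_loop X H) T)"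
    "winding_number (closed_loop_cutoff (vertical_loop X H) T) z = 0"
proof -
  have "path_image (closed_loop_cutoff (vertical_loop X H) T) \<subseteq> {s. Re s \<le> X}"
    unfolding path_image_closed_loop_cutoff path_image_loop_cutoff Un_subset_iff path_image_linepath
    using assms by (intro conjI closed_segment_subset convex_halfspace_Re_le) auto
  then show "z \<notin> path_image (closed_loop_cutoff (vertical_loop X H) T)"
    "winding_number (closed_loop_cutoff (vertical_loop X H) T) z = 0"
    using assms by (auto intro!: winding_number_zero_outside[of _ "{s. Re s \<le> X}"] convex_halfspace_Re_le
        simp: valid_path_imp_path valid_path_closed_loop_cutoff pathfinish_closed_loop_cutoff)
qed

text \<open>
  A vertical segment with its two horizontal rays encloses all points of \<open>L\<close> and \<open>R\<close> to its left.
  Finitely many of them are in \<open>R\<close>; appending a clockwise loop around each of these, based at the upper end of the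
  segment, corrects their winding numbers to 0 and changes no other. This works no matter how \<open>L\<close> and
  \<open>R\<close> are interlaced.
\<close>

lemma separating_loop_exists:
  assumes L: "locally_finite_points L" "\<And>z. z \<in> L \<Longrightarrow> Re z < X" "\<And>z. z \<in> L \<Longrightarrow> \<bar>Im z\<bar> < H"
    and R: "locally_finite_points R" "\<And>z. z \<in> R \<Longrightarrow> Re z \<noteq> X" "\<And>z. z \<in> R \<Longrightarrow> \<bar>Im z\<bar> < H"
    and fin: "finite {z \<in> R. Re z < X}" and disj: "L \<inter> R = {}" and "0 < H"
  shows "\<exists>g. left_loop g \<and> (\<forall>z\<in>L. left_of_loop g z) \<and> (\<forall>z\<in>R. right_of_loop g z)"
proof -
  let ?v = "vertical_loop X H"
  have "Complex X H \<notin> L \<union> R" using L(3) R(3) by force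
  then obtain \<gamma> where \<gamma>: "valid_path \<gamma>" "pathstart \<gamma> = Complex X H" "pathfinish \<gamma> = Complex X H"
      "path_image \<gamma> \<inter> (L \<union> R) = {}"
      "\<forall>d\<in>L \<union> R. winding_number \<gamma> d = (if d \<in> {z \<in> R. Re z < X} then - 1 else 0)"
    using clockwise_loops[OF locally_finite_points_Un[OF L(1) R(1)] fin, of "Complex X H"] by auto
  define g where "g = ?v +++ \<gamma>"
  have g: "valid_path g" "pathstart g = Complex X (- H)" "pathfinish g = Complex X H"
      "path_image g = path_image ?v \<union> path_image \<gamma>"
    using \<gamma> by (auto simp: g_def path_image_join intro!: valid_path_join)
  have *: "z \<notin> path_image (closed_loop_cutoff g T) \<and> winding_number (closed_loop_cutoff g T) z =
      winding_number (closed_loop_cutoff ?v T) z + winding_number \<gamma> z"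
    if "z \<in> L \<union> R" "z \<notin> path_image (closed_loop_cutoff ?v T)" for z T
  proof -
    have z: "z \<notin> path_image \<gamma>" "z \<notin> path_image (closed_loop_cutoff g T)" "z \<notin> path_image ?v"
      using that \<gamma>(4) g by (auto simp: path_image_closed_loop_cutoff path_image_loop_cutoff)
    have "winding_number g z = winding_number ?v z + winding_number \<gamma> z"
      unfolding g_def using z \<gamma> by (intro winding_number_join) (auto simp: valid_path_imp_path)
    then show ?thesis
      using z that(2) winding_number_closed_loop_cutoff[OF g(1) z(2)]
        winding_number_closed_loop_cutoff[OF valid_path_linepath that(2)] g(2,3) by simp
  qed
  have left: "left_of_loop g z" if "z \<in> L" for z
    using eventually_gt_at_bot[of "Re z"] unfolding left_of_loop_def
  proof eventually_elim
    case (elim T)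
    have "winding_number \<gamma> z = 0" using \<gamma>(5) that disj by auto
    then show ?case using winding_number_vertical_loop[OF elim L(2,3)[OF that]] *[of z T] that by auto
  qed
  have right: "right_of_loop g z" if "z \<in> R" for z
    using eventually_gt_at_bot[of "min X (Re z)"] unfolding right_of_loop_def
  proof eventually_elim
    case (elim T)
    show ?case
    proof (cases "Re z < X")
      case True
      then have "winding_number \<gamma> z = - 1" using \<gamma>(5) that by auto
      then show ?thesis using winding_number_vertical_loop[of T z X H] True R(3)[OF that] elim *[of z T] that by auto
    next
      case False
      then have "winding_number \<gamma> z = 0" "X < Re z" using \<gamma>(5) that R(2)[OF that] by auto
      then show ?thesis using winding_number_vertical_loop_outside[of X z T H] elim *[of z T] that by auto
    qed
  qed
  show ?thesis using g left right \<open>0 < H\<close> by (intro exI[of _ g]) (auto simp: left_loop_def)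
qed

section \<open>The integrand as a meromorphic function\<close>

text \<open>
  The integrand of \<^const>\<open>Ghat\<close> with \<open>\<Gamma>(1 - n - s) / \<Gamma>(1 - s)\<close> written as a rational function. Unlike
  the quotient, whose value is 0 at \<open>s = 1, 2, \<dots>\<close> where both Gamma functions have poles, it is
  holomorphic there.
\<close>

definition Ghat_kernel :: "nat \<Rightarrow> complex list \<Rightarrow> complex list \<Rightarrow> real \<Rightarrow> complex \<Rightarrow> complex" where
  "Ghat_kernel n a b t s =
     (\<Prod>c\<leftarrow>a. Gamma (c + (of_nat n - 1 + s))) * (\<Prod>c\<leftarrow>b. rGamma (c + (of_nat n - 1 + s))) /
     pochhammer (1 - of_nat n - s) n * of_real t powr (- s)"

definition Gamma_poles :: "nat \<Rightarrow> complex list \<Rightarrow> complex set" where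
  "Gamma_poles n a = {1 - c - of_nat n - of_nat l | c l. c \<in> set a}"

definition rational_poles :: "nat \<Rightarrow> complex set" where
  "rational_poles n = (\<lambda>k. 1 - of_nat n + of_nat k) ` {..<n}"

abbreviation Ghat_poles :: "nat \<Rightarrow> complex list \<Rightarrow> complex set" where
  "Ghat_poles n a \<equiv> Gamma_poles n a \<union> rational_poles n"

lemma inverse_Gamma_vec: "inverse (Gamma_vec a) = (\<Prod>c\<leftarrow>a. rGamma c)"
  unfolding Gamma_vec_def by (induction a) (auto simp: rGamma_inverse_Gamma)

lemma Ghat_integrand_eq_kernel:
  assumes "\<And>k::nat. s \<noteq> 1 - of_nat n + of_nat k"
  shows "Ghat_integrand n a b t s = Ghat_kernel n a b t s"
proof -
  have "1 - of_nat n - s \<notin> \<int>\<^sub>\<le>\<^sub>0"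
  proof
    assume "1 - of_nat n - s \<in> \<int>\<^sub>\<le>\<^sub>0"
    then obtain k :: nat where "1 - of_nat n - s = - of_nat k" by (elim nonpos_Ints_cases')
    then have "s = 1 - of_nat n + of_nat k" by (simp add: algebra_simps)
    then show False using assms by blast
  qed
  then have "pochhammer (1 - of_nat n - s) n = Gamma (1 - s) / Gamma (1 - of_nat n - s)"
    by (simp add: pochhammer_Gamma)
  moreover have "(\<Prod>c\<leftarrow>b. rGamma (c + \<mu>)) = inverse (Gamma_vec (shift_vec b \<mu>))" for \<mu>
    by (simp add: inverse_Gamma_vec shift_vec_def o_def)
  moreover have "(\<Prod>c\<leftarrow>a. Gamma (c + \<mu>)) = Gamma_vec (shift_vec a \<mu>)" for \<mu>
    by (simp add: Gamma_vec_def shift_vec_def o_def)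
  ultimately show ?thesis
    unfolding Ghat_integrand_def Ghat_kernel_def by (simp add: divide_inverse mult_ac)
qed

lemma prod_list_holomorphic:
  assumes "\<And>c. c \<in> set a \<Longrightarrow> f c holomorphic_on A"
  shows "(\<lambda>s. \<Prod>c\<leftarrow>a. f c s) holomorphic_on A"
  using assms by (induction a) (auto intro!: holomorphic_intros)

lemma pochhammer_holomorphic:
  "f holomorphic_on A \<Longrightarrow> (\<lambda>s. pochhammer (f s) n) holomorphic_on A"
  unfolding pochhammer_prod by (intro holomorphic_intros)

lemma nonpos_Int_iff_Gamma_pole:
  "c + (of_nat n - 1 + s) \<in> \<int>\<^sub>\<le>\<^sub>0 \<longleftrightarrow> (\<exists>l::nat. s = 1 - c - of_nat n - of_nat l)"
proof
  assume "c + (of_nat n - 1 + s) \<in> \<int>\<^sub>\<le>\<^sub>0"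
  then obtain l :: nat where "c + (of_nat n - 1 + s) = - of_nat l" by (elim nonpos_Ints_cases')
  then have "s = 1 - c - of_nat n - of_nat l" by (simp add: algebra_simps eq_neg_iff_add_eq_0)
  then show "\<exists>l::nat. s = 1 - c - of_nat n - of_nat l" by blast
qed auto

lemma Gamma_product_holomorphic:
  "(\<lambda>s. \<Prod>c\<leftarrow>a. Gamma (c + (of_nat n - 1 + s))) holomorphic_on - Gamma_poles n a"
proof (rule prod_list_holomorphic)
  fix c assume "c \<in> set a"
  then show "(\<lambda>s. Gamma (c + (of_nat n - 1 + s))) holomorphic_on - Gamma_poles n a"
    by (intro holomorphic_Gamma' holomorphic_intros)
      (auto simp: nonpos_Int_iff_Gamma_pole Gamma_poles_def)
qed

lemma Ghat_kernel_holomorphic: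
  assumes "0 < t"
  shows "Ghat_kernel n a b t holomorphic_on - Ghat_poles n a"
proof -
  have "pochhammer (1 - of_nat n - s) n \<noteq> 0" if "s \<notin> rational_poles n" for s
  proof
    assume "pochhammer (1 - of_nat n - s) n = 0"
    then obtain k where "k < n" "1 - of_nat n - s = - of_nat k" by (auto simp: pochhammer_eq_0_iff)
    then have "k < n" "s = 1 - of_nat n + of_nat k" by (auto simp: algebra_simps)
    then show False using that by (auto simp: rational_poles_def)
  qed
  then show ?thesis
    unfolding Ghat_kernel_def using assms
    by (intro holomorphic_intros prod_list_holomorphic pochhammer_holomorphic
        holomorphic_on_subset[OF Gamma_product_holomorphic]) auto
qed

lemma left_discrete_Gamma_poles: "left_discrete (Gamma_poles n a)"
  unfolding left_discrete_def
proof
  fix T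
  have "{p \<in> Gamma_poles n a. T \<le> Re p} \<subseteq>
      (\<Union>c\<in>set a. (\<lambda>l. 1 - c - of_nat n - of_nat l) ` {..nat \<lceil>1 - Re c - real n - T\<rceil>})"
    unfolding Gamma_poles_def by (force simp: le_nat_iff le_ceiling_iff)
  then show "finite {p \<in> Gamma_poles n a. T \<le> Re p}"
    by (rule finite_subset) auto
qed

lemma left_discrete_Ghat_poles: "left_discrete (Ghat_poles n a)"
  by (intro left_discrete_Un left_discrete_Gamma_poles)
    (simp add: left_discrete_def rational_poles_def)

lemma norm_shift_ratio:
  fixes c d u :: complex
  assumes "1 < \<theta>" "norm c \<le> B" "norm d \<le> B" "B * (1 + \<theta>) / (\<theta> - 1) \<le> norm u"
  shows "norm (d + u) \<le> \<theta> * norm (c + u)"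
proof -
  have "norm (d + u) \<le> B + norm u" using norm_triangle_ineq[of d u] assms by linarith
  also have "\<dots> \<le> \<theta> * (norm u - B)" using assms by (simp add: field_simps)
  also have "\<dots> \<le> \<theta> * norm (c + u)"
    using assms norm_diff_ineq[of u c] by (intro mult_left_mono) (auto simp: add.commute)
  finally show ?thesis .
qed

text \<open>
  Replacing \<open>w\<close> by \<open>w - 1\<close> multiplies each quotient \<open>\<Gamma>(c + w) / \<Gamma>(d + w)\<close> by
  \<open>(d + w - 1) / (c + w - 1)\<close>.
  The recurrence \<open>\<Gamma>(z + 1) = z \<Gamma>(z)\<close> holds at the poles \<open>z \<noteq> 0\<close> as well, where
  \<open>\<Gamma>\<close> has the default value 0.
\<close>

lemma Gamma_product_contraction:
  assumes "length a = length b" "1 < \<theta>"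
    and "\<And>c. c \<in> set a \<Longrightarrow> c + w - 1 \<noteq> 0"
    and "\<And>c d. c \<in> set a \<Longrightarrow> d \<in> set b \<Longrightarrow> norm (d + w - 1) \<le> \<theta> * norm (c + w - 1)"
  shows "norm ((\<Prod>c\<leftarrow>a. Gamma (c + (w - 1))) * (\<Prod>c\<leftarrow>b. rGamma (c + (w - 1)))) \<le>
    \<theta> ^ length a * norm ((\<Prod>c\<leftarrow>a. Gamma (c + w)) * (\<Prod>c\<leftarrow>b. rGamma (c + w)))"
  using assms(1,3,4)
proof (induction a b rule: list_induct2)
  case (Cons c a d b)
  have nz: "c + w - 1 \<noteq> 0" using Cons.prems by auto
  have "Gamma (c + (w - 1) + 1) = (c + (w - 1)) * Gamma (c + (w - 1))"
  proof (cases "c + (w - 1) \<in> \<int>\<^sub>\<le>\<^sub>0")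
    case True
    then obtain k :: nat where k: "c + (w - 1) = - of_nat k" by (elim nonpos_Ints_cases')
    then have "k \<noteq> 0" using nz by (metis add_diff_eq neg_equal_0_iff_equal of_nat_0)
    then have "c + (w - 1) + 1 = - of_nat (k - 1)" using k by (cases k) auto
    then have "c + (w - 1) + 1 \<in> \<int>\<^sub>\<le>\<^sub>0" by simp
    with True show ?thesis by (simp add: Gamma_eq_zero_iff[THEN iffD2])
  qed (rule Gamma_plus1)
  then have G: "norm (Gamma (c + w)) = norm (c + w - 1) * norm (Gamma (c + (w - 1)))"
    by (simp add: add_diff_eq flip: norm_mult)
  have "(d + (w - 1)) * rGamma (d + (w - 1) + 1) = rGamma (d + (w - 1))" by (rule rGamma_plus1)
  then have r: "norm (rGamma (d + (w - 1))) = norm (d + w - 1) * norm (rGamma (d + w))"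
    by (simp add: add_diff_eq flip: norm_mult)
  have "norm (Gamma (c + (w - 1))) * norm (rGamma (d + (w - 1))) =
      norm (Gamma (c + (w - 1))) * norm (rGamma (d + w)) * norm (d + w - 1)"
    by (simp add: r)
  also have "\<dots> \<le> norm (Gamma (c + (w - 1))) * norm (rGamma (d + w)) * (\<theta> * norm (c + w - 1))"
    using Cons.prems by (intro mult_left_mono) auto
  also have "\<dots> = \<theta> * (norm (Gamma (c + w)) * norm (rGamma (d + w)))"
    by (simp add: G)
  finally have one: "norm (Gamma (c + (w - 1))) * norm (rGamma (d + (w - 1))) \<le>
      \<theta> * (norm (Gamma (c + w)) * norm (rGamma (d + w)))" .
  have "norm ((\<Prod>c\<leftarrow>a. Gamma (c + (w - 1))) * (\<Prod>c\<leftarrow>b. rGamma (c + (w - 1)))) \<le>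
    \<theta> ^ length a * norm ((\<Prod>c\<leftarrow>a. Gamma (c + w)) * (\<Prod>c\<leftarrow>b. rGamma (c + w)))"
    using Cons by auto
  from mult_mono[OF one this] show ?case
    using assms(2) by (simp add: norm_mult mult_ac)
qed auto

text \<open>
  Under a shift by \<open>-1\<close> the kernel is multiplied by \<open>t\<close> and by \<open>p + 1\<close> quotients of linear factors
  that tend to 1. The constants \<open>q\<close> and \<open>R\<close> depend only on a bound for the parameters \<open>a\<close>; this
  uniformity is what makes the integral depend holomorphically on them.
\<close>

lemma Ghat_kernel_contracting:
  assumes "0 < t" "t < 1"
  shows "\<exists>q R. \<forall>a. length a = length b \<longrightarrow> (\<forall>c\<in>set a. norm c \<le> B) \<longrightarrow>
    left_contracting q R (Ghat_kernel n a b t)"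
proof -
  let ?p = "length b"
  \<comment> \<open>\<open>\<theta>\<close> bounds each of the \<open>p\<close> quotients from the Gamma functions and the one from the rational
    factor.\<close>
  have "((\<lambda>\<theta>. \<theta> ^ (?p + 1) * t) \<longlongrightarrow> 1 ^ (?p + 1) * t) (at_right 1)"
    by (intro tendsto_intros)
  then have "\<forall>\<^sub>F \<theta> in at_right 1. \<theta> ^ (?p + 1) * t < 1"
    using assms by (intro order_tendstoD(2)) auto
  then have "\<forall>\<^sub>F \<theta> in at_right 1. \<theta> ^ (?p + 1) * t < 1 \<and> 1 < \<theta>"
    by (intro eventually_conj eventually_at_right_less)
  then obtain \<theta> where \<theta>: "\<theta> ^ (?p + 1) * t < 1" "1 < \<theta>"
    using eventually_happens'[OF trivial_limit_at_right_real] by blast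
  define C where "C = Max (insert (max B (real n)) (norm ` set b))"
  have C: "B \<le> C" "real n \<le> C" "\<And>d. d \<in> set b \<Longrightarrow> norm d \<le> C"
  proof -
    have "max B (real n) \<le> C" unfolding C_def by (rule Max_ge) auto
    then show "B \<le> C" "real n \<le> C" by auto
  qed (auto simp: C_def simp del: Max_insert intro: Max_ge)
  \<comment> \<open>Beyond \<open>M\<close> the estimate \<open>norm_shift_ratio\<close> applies to all parameters and to the shift by \<open>n\<close>.\<close>
  define M where "M = C * (1 + \<theta>) / (\<theta> - 1)"
  have "C * (\<theta> - 1) \<le> C * (1 + \<theta>)" using C(2) by (intro mult_left_mono) auto
  then have M: "C \<le> M" using \<theta> by (simp add: M_def pos_le_divide_eq)
  have far: "M < norm u" if "Re u < - M" for u :: complex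
    using that abs_Re_le_cmod[of u] C(2) M by linarith
  have far': "M < norm u" if "M < Re u" for u :: complex
    using that abs_Re_le_cmod[of u] by linarith
  have "left_contracting (\<theta> ^ (?p + 1) * t) (- M - real n) (Ghat_kernel n a b t)"
    if a: "length a = ?p" "\<And>c. c \<in> set a \<Longrightarrow> norm c \<le> B" for a
    unfolding left_contracting_def
  proof (intro conjI allI impI)
    fix s :: complex assume s: "Re s \<le> - M - real n"
    define w where "w = of_nat n - 1 + s"
    define z where "z = 1 - of_nat n - s"
    have u: "M < norm (w - 1)" using s by (intro far) (auto simp: w_def)
    have v: "M < norm (1 - s)" using s C M by (intro far') auto
    have 1: "norm ((\<Prod>c\<leftarrow>a. Gamma (c + (w - 1))) * (\<Prod>c\<leftarrow>b. rGamma (c + (w - 1)))) \<le>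
      \<theta> ^ ?p * norm ((\<Prod>c\<leftarrow>a. Gamma (c + w)) * (\<Prod>c\<leftarrow>b. rGamma (c + w)))"
      unfolding a(1)[symmetric]
    proof (rule Gamma_product_contraction[OF a(1) \<theta>(2)])
      fix c assume c: "c \<in> set a"
      then have nc: "norm c \<le> C" using a(2) C(1) order_trans by blast
      have "norm c < norm (w - 1)" using nc u M by linarith
      then show "c + w - 1 \<noteq> 0"
        using norm_minus_cancel[of c] by (metis add_diff_eq add_eq_0_iff order_less_irrefl)
      fix d assume "d \<in> set b"
      then show "norm (d + w - 1) \<le> \<theta> * norm (c + w - 1)"
        using norm_shift_ratio[OF \<theta>(2) nc C(3), of d "w - 1"] u by (simp add: M_def add_diff_eq)
    qed
    have nz: "z + of_nat n \<noteq> 0" using v C(2) M by (auto simp: z_def)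
    have "pochhammer (z + 1) n * z = pochhammer z n * (z + of_nat n)"
      using pochhammer_rec[of z n] pochhammer_rec'[of z n] by (simp add: mult_ac)
    moreover have "z \<noteq> 0" using s C(2) M by (auto simp: z_def complex_eq_iff)
    ultimately have "norm (pochhammer (z + 1) n) = norm (pochhammer z n) * norm (z + of_nat n) / norm z"
      by (simp add: field_simps flip: norm_mult)
    moreover have "norm z \<le> \<theta> * norm (z + of_nat n)"
      using norm_shift_ratio[OF \<theta>(2), of 0 C "- of_nat n" "1 - s"] v C(2) by (simp add: M_def z_def algebra_simps)
    then have "norm z / norm (z + of_nat n) \<le> \<theta>" using nz by (simp add: pos_divide_le_eq)
    ultimately have 2: "1 / norm (pochhammer (z + 1) n) \<le> \<theta> * (1 / norm (pochhammer z n))"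
      using mult_right_mono[of "norm z / norm (z + of_nat n)" \<theta> "1 / norm (pochhammer z n)"]
      by (simp add: mult_ac)
    have "of_real t powr (- (s - 1)) = of_real t powr (- s) * of_real t"
      using assms powr_add[of "of_real t :: complex" "- s" 1] by (simp add: algebra_simps)
    then have 3: "norm (of_real t powr (- (s - 1))) = norm (of_real t powr (- s) :: complex) * t"
      using assms by (simp add: norm_mult)
    have "norm (Ghat_kernel n a b t (s - 1)) =
        norm ((\<Prod>c\<leftarrow>a. Gamma (c + (w - 1))) * (\<Prod>c\<leftarrow>b. rGamma (c + (w - 1)))) *
        (1 / norm (pochhammer (z + 1) n)) * norm (of_real t powr (- (s - 1)) :: complex)"
    proof -
      have "of_nat n - 1 + (s - 1) = w - 1" "1 - of_nat n - (s - 1) = z + 1"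
        by (auto simp: w_def z_def)
      then show ?thesis by (simp only: Ghat_kernel_def norm_mult norm_divide) simp
    qed
    also have "\<dots> \<le> (\<theta> ^ ?p * norm ((\<Prod>c\<leftarrow>a. Gamma (c + w)) * (\<Prod>c\<leftarrow>b. rGamma (c + w)))) *
        (\<theta> * (1 / norm (pochhammer z n))) * (norm (of_real t powr (- s) :: complex) * t)"
      unfolding 3 using 1 2 assms \<theta> by (intro mult_mono) auto
    also have "\<dots> = \<theta> ^ (?p + 1) * t * norm (Ghat_kernel n a b t s)"
      unfolding Ghat_kernel_def w_def[symmetric] z_def[symmetric] by (simp add: norm_mult norm_divide)
    finally show "norm (Ghat_kernel n a b t (s - 1)) \<le> \<theta> ^ (?p + 1) * t * norm (Ghat_kernel n a b t s)" .
  qed (use \<theta> assms in auto)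
  then show ?thesis by blast
qed

section \<open>Residues at the rational poles\<close>

text \<open>
  The product over \<open>i\<close> collects the values at \<open>1 - n + j\<close> of the linear factors of \<open>(1 - n - s)\<^sub>n\<close> other
  than the vanishing one. It equals \<open>(-1)\<^sup>j j! (n - 1 - j)!\<close>, and \<open>(1 - n)\<^sub>j\<close> equals
  \<open>(-1)\<^sup>j (n - 1)! / (n - 1 - j)!\<close>.
\<close>

lemma prod_differences_pochhammer:
  assumes "j < n"
  shows "pochhammer (1 - of_nat n) j * (\<Prod>i\<in>{..<n} - {j}. of_nat i - of_nat j) =
    (fact (n - 1) * fact j :: complex)"
proof -
  define m where "m = n - 1 - j"
  have n: "n = Suc (j + m)" using assms by (simp add: m_def)
  have split: "{..<n} - {j} = {..<j} \<union> (\<lambda>i. Suc j + i) ` {..<m}"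
  proof -
    have "x \<in> (\<lambda>i. Suc j + i) ` {..<m}" if "x < n" "x \<noteq> j" "\<not> x < j" for x
      using that n by (intro image_eqI[of _ _ "x - Suc j"]) auto
    then show ?thesis using n by auto
  qed
  have "(\<Prod>i\<in>{..<n} - {j}. of_nat i - of_nat j :: complex) =
      (\<Prod>i<j. of_nat i - of_nat j) * (\<Prod>i\<in>(\<lambda>i. Suc j + i) ` {..<m}. of_nat i - of_nat j)"
    unfolding split by (rule prod.union_disjoint) auto
  also have "(\<Prod>i<j. of_nat i - of_nat j :: complex) = pochhammer (- of_nat j) j"
    by (simp add: pochhammer_prod atLeast0LessThan add.commute)
  also have "\<dots> = (- 1) ^ j * fact j" by (rule pochhammer_same)
  also have "(\<Prod>i\<in>(\<lambda>i. Suc j + i) ` {..<m}. of_nat i - of_nat j :: complex) = (\<Prod>i<m. of_nat (Suc i))"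
    by (subst prod.reindex) (auto simp: inj_on_def)
  also have "\<dots> = fact m" by (simp add: fact_prod_Suc atLeast0LessThan)
  finally have 1: "(\<Prod>i\<in>{..<n} - {j}. of_nat i - of_nat j :: complex) = (- 1) ^ j * fact j * fact m" .
  have "pochhammer (- of_nat (j + m)) (j + m) =
      pochhammer (- of_nat (j + m)) j * pochhammer (- of_nat (j + m) + of_nat j :: complex) m"
    by (rule pochhammer_product') 
  also have "- of_nat (j + m) + of_nat j = (- of_nat m :: complex)" by simp
  finally have "(- 1) ^ (j + m) * fact (j + m) = pochhammer (- of_nat (j + m)) j * ((- 1) ^ m * fact m :: complex)"
    by (simp only: pochhammer_same)
  then have "(- 1) ^ m * ((- 1) ^ j * fact (j + m)) =
      (- 1) ^ m * (pochhammer (- of_nat (j + m)) j * fact m :: complex)"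
    by (simp only: power_add mult_ac)
  then have 2: "pochhammer (- of_nat (j + m)) j * fact m = ((- 1) ^ j * fact (j + m) :: complex)"
    by simp
  have "pochhammer (1 - of_nat n) j * (\<Prod>i\<in>{..<n} - {j}. of_nat i - of_nat j) =
      ((- 1) ^ j * fact j) * (pochhammer (- of_nat (j + m)) j * fact m :: complex)"
    unfolding 1 by (simp add: n mult_ac)
  also have "\<dots> = ((- 1) ^ j * (- 1) ^ j) * (fact (j + m) * fact j)"
    unfolding 2 by (simp only: mult_ac)
  also have "\<dots> = fact (n - 1) * fact j"
    by (simp add: n flip: power_mult_distrib)
  finally show ?thesis .
qed

text \<open>
  The pole is at most simple: exactly one factor of \<open>(1 - n - s)\<^sub>n\<close> vanishes there, and the Gamma functions have
  no pole because no \<open>-c\<close> is a natural number. They take the values \<open>\<Gamma>(c + j) = \<Gamma>(c) (c)\<^sub>j\<close>, whence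
  the term with index \<open>j\<close> of the terminating series.
\<close>

lemma residue_Ghat_kernel:
  assumes "0 < t" and a: "\<And>c. c \<in> set a \<Longrightarrow> - c \<notin> \<nat>" and j: "j < n"
  shows "residue (Ghat_kernel n a b t) (1 - of_nat n + of_nat j) =
    - Gamma_vec a * (of_real t ^ (n - 1) / fact (n - 1) *
      (pochhammer (1 - of_nat n) j * pochhammer_vec a j / (Gamma_vec (shift_vec b (of_nat j)) * fact j) *
       (1 / of_real t) ^ j))"
proof -
  define p :: complex where "p = 1 - of_nat n + of_nat j"
  define D where "D s = (\<Prod>i\<in>{..<n} - {j}. 1 - of_nat n - s + of_nat i)" for s :: complex
  \<comment> \<open>The sign comes from the vanishing factor, which is \<open>p - s\<close>.\<close>
  define f where "f s = - ((\<Prod>c\<leftarrow>a. Gamma (c + (of_nat n - 1 + s))) * (\<Prod>c\<leftarrow>b. rGamma (c + (of_nat n - 1 + s))) /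
     D s * of_real t powr (- s))" for s
  have "pochhammer (1 - of_nat n - s) n = - (s - p) * D s" for s
  proof -
    have "pochhammer (1 - of_nat n - s) n = (\<Prod>i<n. 1 - of_nat n - s + of_nat i)"
      by (simp add: pochhammer_prod atLeast0LessThan)
    also have "\<dots> = (1 - of_nat n - s + of_nat j) * D s"
      unfolding D_def using j by (intro prod.remove) auto
    finally show ?thesis by (simp add: p_def algebra_simps)
  qed
  moreover have "A / (- u * d) * E = - (A / d * E) / u" for A u d E :: complex
    by (simp add: divide_inverse mult_ac)
  ultimately have kernel: "Ghat_kernel n a b t = (\<lambda>s. f s / (s - p))"
    by (intro ext) (simp only: Ghat_kernel_def f_def)
  define S where "S = - (Gamma_poles n a \<union> (rational_poles n - {p}))"
  have "open S"
    unfolding S_def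
    by (intro open_Compl left_discrete_closed left_discrete_subset[OF left_discrete_Ghat_poles[of n a]]) auto
  have "p \<notin> Gamma_poles n a"
  proof
    assume "p \<in> Gamma_poles n a"
    then obtain c l where c: "c \<in> set a" "p = 1 - c - of_nat n - of_nat l" by (auto simp: Gamma_poles_def)
    then have "c + of_nat (j + l) = 0" by (simp add: p_def algebra_simps)
    then have "- c = of_nat (j + l)" by (rule minus_unique)
    then show False using a[OF c(1)] by (metis of_nat_in_Nats)
  qed
  then have "p \<in> S" by (simp add: S_def)
  have D0: "D s \<noteq> 0" if "s \<in> S" for s
  proof
    assume "D s = 0"
    then obtain i where i: "i < n" "i \<noteq> j" "1 - of_nat n - s + of_nat i = 0" by (auto simp: D_def)
    then have "s = 1 - of_nat n + of_nat i" by (simp add: algebra_simps)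
    then have "s \<in> rational_poles n - {p}" using i by (auto simp: rational_poles_def p_def)
    then show False using that by (simp add: S_def)
  qed
  have "f holomorphic_on S"
    unfolding f_def using \<open>0 < t\<close> D0
    by (intro holomorphic_intros prod_list_holomorphic holomorphic_on_subset[OF Gamma_product_holomorphic])
      (auto simp: S_def D_def intro!: holomorphic_intros)
  then have "residue (Ghat_kernel n a b t) p = f p"
    unfolding kernel using \<open>open S\<close> \<open>p \<in> S\<close> by (intro residue_simple)
  also have "f p = - (Gamma_vec (shift_vec a (of_nat j)) / Gamma_vec (shift_vec b (of_nat j)) / D p * of_real t powr (- p))"
  proof -
    have "of_nat n - 1 + p = of_nat j" by (simp add: p_def)
    moreover have "(\<Prod>c\<leftarrow>b. rGamma (c + of_nat j)) = inverse (Gamma_vec (shift_vec b (of_nat j)))"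
      by (simp add: inverse_Gamma_vec shift_vec_def o_def)
    ultimately show ?thesis by (simp add: f_def Gamma_vec_def shift_vec_def o_def divide_inverse)
  qed
  also have "Gamma_vec (shift_vec a (of_nat j)) = Gamma_vec a * pochhammer_vec a j"
    using a
  proof (induction a)
    case (Cons c a)
    have "c \<notin> \<int>\<^sub>\<le>\<^sub>0" using Cons.prems[of c] by (auto elim!: nonpos_Ints_cases')
    then have "Gamma (c + of_nat j) = Gamma c * pochhammer c j"
      using pochhammer_Gamma[of c j] Gamma_eq_zero_iff[of c] by simp
    then show ?case using Cons by (simp add: Gamma_vec_def shift_vec_def pochhammer_vec_def mult_ac)
  qed (simp add: Gamma_vec_def shift_vec_def pochhammer_vec_def)
  also have "D p = (\<Prod>i\<in>{..<n} - {j}. of_nat i - of_nat j)"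
    unfolding D_def by (intro prod.cong) (auto simp: p_def)
  also have "\<dots> = fact (n - 1) * fact j / pochhammer (1 - of_nat n) j"
  proof -
    have "pochhammer (1 - of_nat n) j \<noteq> (0 :: complex)"
      using prod_differences_pochhammer[OF j] by (metis fact_nonzero mult_eq_0_iff)
    then show ?thesis using prod_differences_pochhammer[OF j] by (simp add: field_simps)
  qed
  also have "of_real t powr (- p) = (of_real t ^ (n - 1) * (1 / of_real t) ^ j :: complex)"
  proof -
    have "- p = of_nat (n - 1) - of_nat j" using j by (simp add: p_def of_nat_diff)
    then have "of_real t powr (- p) = (of_real t powr of_nat (n - 1) / of_real t powr of_nat j :: complex)"
      by (simp only: powr_diff)
    also have "\<dots> = of_real t ^ (n - 1) / of_real t ^ j"
      using \<open>0 < t\<close> by (simp add: powr_nat')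
    finally show ?thesis by (simp add: power_divide)
  qed
  finally show ?thesis
    unfolding p_def by (simp add: divide_inverse mult_ac)
qed

lemma sum_residues_Ghat_kernel:
  assumes "0 < t" and a: "\<And>c. c \<in> set a \<Longrightarrow> - c \<notin> \<nat>"
  shows "(\<Sum>p\<in>rational_poles n. residue (Ghat_kernel n a b t) p) =
    - Gamma_vec a * (of_real t ^ (n - 1) / fact (n - 1) * hypergeo_over_Gamma n a b (1 / of_real t))"
proof -
  have "inj_on (\<lambda>k. 1 - of_nat n + of_nat k :: complex) {..<n}" by (auto simp: inj_on_def)
  then show ?thesis
    unfolding rational_poles_def hypergeo_over_Gamma_def
    by (simp add: sum.reindex residue_Ghat_kernel[OF assms] sum_distrib_left)
qed

section \<open>Integrals along loops that enclose every pole\<close>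

text \<open>
  For parameters \<open>a\<close> of modulus at most \<open>B\<close> every pole lies in the half-strip that this loop bounds.
\<close>

abbreviation enclosing_loop :: "real \<Rightarrow> real \<Rightarrow> complex" where
  "enclosing_loop B \<equiv> vertical_loop (B + 2) (B + 1)"

lemma Ghat_poles_bound:
  assumes "\<And>c. c \<in> set a \<Longrightarrow> norm c \<le> B" "0 \<le> B" "p \<in> Ghat_poles n a"
  shows "Re p \<le> B + 1" "\<bar>Im p\<bar> \<le> B"
proof -
  have "Re p \<le> B + 1 \<and> \<bar>Im p\<bar> \<le> B"
    using assms(3)
  proof
    assume "p \<in> Gamma_poles n a"
    then obtain c l where c: "c \<in> set a" "p = 1 - c - of_nat n - of_nat l" by (auto simp: Gamma_poles_def)
    then show ?thesis
      using assms(1)[OF c(1)] abs_Re_le_cmod[of c] abs_Im_le_cmod[of c] by auto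
  next
    assume "p \<in> rational_poles n"
    then show ?thesis using assms(2) by (auto simp: rational_poles_def)
  qed
  then show "Re p \<le> B + 1" "\<bar>Im p\<bar> \<le> B" by auto
qed

lemma left_of_enclosing_loop:
  assumes "\<And>c. c \<in> set a \<Longrightarrow> norm c \<le> B" "0 \<le> B" "p \<in> Ghat_poles n a"
  shows "left_of_loop (enclosing_loop B) p"
  using Ghat_poles_bound[OF assms] by (intro left_of_vertical_loop) auto

lemma Ghat_kernel_loop_integral_exists:
  assumes "0 < t" "t < 1" "length a = length b" "valid_path g"
    and sides: "\<And>p. p \<in> Ghat_poles n a \<Longrightarrow> left_of_loop g p \<or> right_of_loop g p"
  shows "\<exists>v. has_loop_integral (Ghat_kernel n a b t) v g"
proof -
  have "\<forall>c\<in>set a. norm c \<le> Max (insert 0 (norm ` set a))" by (auto simp del: Max_insert intro: Max_ge)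
  then obtain q R where "left_contracting q R (Ghat_kernel n a b t)"
    using Ghat_kernel_contracting[OF assms(1,2), of b] assms(3) by blast
  moreover have "open (- Ghat_poles n a)" using left_discrete_closed[OF left_discrete_Ghat_poles] by blast
  moreover have "path_image (loop_cutoff g T) \<subseteq> - Ghat_poles n a" if "T \<le> ray_top g" for T
    using loop_cutoff_avoids[OF sides that] by blast
  ultimately show ?thesis
    using loop_integral_exists[OF assms(4) _ _ Ghat_kernel_holomorphic[OF assms(1)]] by blast
qed

lemma Ghat_kernel_loop_integral_compare:
  assumes "0 < t" "t < 1" "length a = length b" "valid_path g" "valid_path g'"
    and "\<And>p. p \<in> Ghat_poles n a \<Longrightarrow> left_of_loop g p \<or> right_of_loop g p"
    and "\<And>p. p \<in> Ghat_poles n a \<Longrightarrow> left_of_loop g' p"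
    and "Q = {p \<in> Ghat_poles n a. right_of_loop g p}" "finite Q"
    and "has_loop_integral (Ghat_kernel n a b t) v g" "has_loop_integral (Ghat_kernel n a b t) v' g'"
  shows "v = v' - 2 * pi * \<i> * (\<Sum>p\<in>Q. residue (Ghat_kernel n a b t) p)"
proof -
  have "\<forall>c\<in>set a. norm c \<le> Max (insert 0 (norm ` set a))" by (auto simp del: Max_insert intro: Max_ge)
  then obtain q R where "left_contracting q R (Ghat_kernel n a b t)"
    using Ghat_kernel_contracting[OF assms(1,2), of b] assms(3) by blast
  then show ?thesis
    using loop_integral_compare[OF left_discrete_Ghat_poles Ghat_kernel_holomorphic[OF assms(1)] _ assms(4-)] by blast
qed

text \<open>
  The quantity \<open>I(a)\<close>. Leaving \<open>B\<close> open lets one loop serve all parameters near a given one.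
\<close>

definition enclosing_integral :: "nat \<Rightarrow> complex list \<Rightarrow> complex list \<Rightarrow> real \<Rightarrow> complex" where
  "enclosing_integral n a b t =
     (THE w. \<exists>B v. 0 \<le> B \<and> (\<forall>c\<in>set a. norm c \<le> B) \<and>
       has_loop_integral (Ghat_kernel n a b t) v (enclosing_loop B) \<and> w = v / (2 * of_real pi * \<i>))"

lemma has_loop_integral_enclosing_loop:
  assumes t: "0 < t" "t < 1" and len: "length a = length b" and B: "0 \<le> B" "\<forall>c\<in>set a. norm c \<le> B"
  shows "has_loop_integral (Ghat_kernel n a b t) (2 * of_real pi * \<i> * enclosing_integral n a b t) (enclosing_loop B)"
proof -
  let ?P = "\<lambda>w. \<exists>B v. 0 \<le> B \<and> (\<forall>c\<in>set a. norm c \<le> B) \<and>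
       has_loop_integral (Ghat_kernel n a b t) v (enclosing_loop B) \<and> w = v / (2 * of_real pi * \<i>)"
  have left: "left_of_loop (enclosing_loop B') p" if "0 \<le> B'" "\<forall>c\<in>set a. norm c \<le> B'" "p \<in> Ghat_poles n a" for B' p
    using that left_of_enclosing_loop by blast
  have unique: "v = v'" if "0 \<le> B'" "\<forall>c\<in>set a. norm c \<le> B'" "has_loop_integral (Ghat_kernel n a b t) v (enclosing_loop B')"
    "0 \<le> B''" "\<forall>c\<in>set a. norm c \<le> B''" "has_loop_integral (Ghat_kernel n a b t) v' (enclosing_loop B'')" for v v' B' B''
  proof -
    have "{} = {p \<in> Ghat_poles n a. right_of_loop (enclosing_loop B') p}"
      using left[OF that(1,2)] not_left_and_right by blast
    from Ghat_kernel_loop_integral_compare[OF t len valid_path_linepath valid_path_linepath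
        disjI1[OF left[OF that(1,2)]] left[OF that(4,5)] this finite.emptyI that(3,6)]
    show ?thesis by simp
  qed
  obtain v where v: "has_loop_integral (Ghat_kernel n a b t) v (enclosing_loop B)"
    using Ghat_kernel_loop_integral_exists[OF t len valid_path_linepath, of n "Complex (B + 2) (- (B + 1))" "Complex (B + 2) (B + 1)"]
      left[OF B] by blast
  have "enclosing_integral n a b t = v / (2 * of_real pi * \<i>)"
    unfolding enclosing_integral_def
  proof (rule the_equality)
    show "?P (v / (2 * of_real pi * \<i>))" using B v by blast
    show "w = v / (2 * of_real pi * \<i>)" if "?P w" for w
      using that unique[OF _ _ _ B v] by blast
  qed
  then show ?thesis using v by simp
qed

section \<open>Holomorphic dependence on one parameter\<close>

text \<open>
  Differentiation under the integral sign.
\<close>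

lemma holomorphic_on_linepath_integral:
  assumes G: "G holomorphic_on S" "open S" and \<psi>: "continuous_on (closed_segment u v) \<psi>"
    and U: "convex U" "\<And>z s. z \<in> U \<Longrightarrow> s \<in> closed_segment u v \<Longrightarrow> z + s \<in> S"
  shows "(\<lambda>z. contour_integral (linepath u v) (\<lambda>s. G (z + s) * \<psi> s)) holomorphic_on U"
proof -
  let ?l = "linepath u v"
  have l: "?l x \<in> closed_segment u v" if "x \<in> cbox 0 1" for x
    using that linepath_in_path[of x u v] by simp
  have lcont: "continuous_on A ?l" for A by (simp add: continuous_on_linepath)
  have \<psi>l: "continuous_on (cbox 0 1) (\<lambda>x. \<psi> (?l x))"
    using l by (intro continuous_on_compose2[OF \<psi> lcont]) auto
  have dG: "deriv G holomorphic_on S" using G by (rule holomorphic_deriv)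
  have "(\<lambda>z. integral (cbox 0 1) (\<lambda>x. G (z + ?l x) * \<psi> (?l x) * (v - u))) holomorphic_on U"
  proof (rule leibniz_rule_holomorphic[where fx = "\<lambda>z x. deriv G (z + ?l x) * \<psi> (?l x) * (v - u)"])
    fix z x assume zx: "z \<in> U" "x \<in> cbox 0 (1::real)"
    have "(G has_field_derivative deriv G (z + ?l x)) (at (z + ?l x))"
      using G U(2)[OF zx(1) l[OF zx(2)]] by (simp add: holomorphic_derivI)
    then have "((\<lambda>z. G (z + ?l x)) has_field_derivative deriv G (z + ?l x)) (at z)"
      by (simp add: DERIV_shift)
    then show "((\<lambda>z. G (z + ?l x) * \<psi> (?l x) * (v - u)) has_field_derivative
        deriv G (z + ?l x) * \<psi> (?l x) * (v - u)) (at z within U)"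
      by (intro DERIV_cmult_right) (rule has_field_derivative_at_within)
  next
    fix z assume z: "z \<in> U"
    have "continuous_on (cbox 0 1) (\<lambda>x. G (z + ?l x))"
      using U(2)[OF z] l
      by (intro continuous_on_compose2[OF holomorphic_on_imp_continuous_on[OF G(1)]] continuous_intros lcont) auto
    then show "(\<lambda>x. G (z + ?l x) * \<psi> (?l x) * (v - u)) integrable_on cbox 0 1"
      by (intro integrable_continuous continuous_intros \<psi>l)
  next
    have "continuous_on (U \<times> cbox 0 1) (\<lambda>p. deriv G (fst p + ?l (snd p)))"
      using U(2) l
      by (intro continuous_on_compose2[OF holomorphic_on_imp_continuous_on[OF dG]] continuous_intros
          continuous_on_compose2[OF lcont[of UNIV]]) auto
    moreover have "continuous_on (U \<times> cbox 0 1) (\<lambda>p. \<psi> (?l (snd p)))"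
      by (intro continuous_on_compose2[OF \<psi>l] continuous_intros) auto
    ultimately show "continuous_on (U \<times> cbox 0 1) (\<lambda>(z, x). deriv G (z + ?l x) * \<psi> (?l x) * (v - u))"
      unfolding case_prod_unfold by (intro continuous_intros)
  qed (use U in auto)
  then show ?thesis by (simp add: contour_integral_integral mult.assoc)
qed

lemma prod_list_update:
  fixes f :: "'a \<Rightarrow> 'b :: comm_monoid_mult"
  assumes "i < length a"
  shows "(\<Prod>c\<leftarrow>a[i := z]. f c) = f z * (\<Prod>c\<leftarrow>take i a @ drop (Suc i) a. f c)"
  using assms by (simp add: upd_conv_take_nth_drop mult_ac)

lemma Ghat_kernel_update:
  assumes "i < length a"
  shows "Ghat_kernel n (a[i := z]) b t s =
    Gamma (z + s + (of_nat n - 1)) * Ghat_kernel n (take i a @ drop (Suc i) a) b t s"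
proof -
  have "z + (of_nat n - 1 + s) = z + s + (of_nat n - 1)" by simp
  then show ?thesis
    by (simp only: Ghat_kernel_def prod_list_update[OF assms] divide_inverse mult_ac)
qed

text \<open>
  For \<open>z\<close> in a ball of radius 1 a single enclosing loop and a single contraction constant serve all
  parameter vectors. On that ball the integrals over the cut-off loops are holomorphic in \<open>z\<close> and
  converge uniformly, because \<open>h\<close> is bounded on the compact product of the ball with two horizontal
  segments of length 1.
\<close>

lemma enclosing_integral_holomorphic:
  assumes t: "0 < t" "t < 1" and len: "length a = length b" and i: "i < length a"
  shows "(\<lambda>z. enclosing_integral n (a[i := z]) b t) holomorphic_on UNIV"
proof -
  have "(\<lambda>z. enclosing_integral n (a[i := z]) b t) holomorphic_on ball z0 1" for z0
  proof -
    let ?a = "take i a @ drop (Suc i) a"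
    let ?h = "\<lambda>z. Ghat_kernel n (a[i := z]) b t"
    define B where "B = Max (insert (norm z0 + 1) (norm ` set a))"
    have zB: "norm z0 + 1 \<le> B" unfolding B_def by (rule Max_ge) auto
    have cB: "norm c \<le> B" if "c \<in> set a" for c
      unfolding B_def using that by (intro Max_ge) auto
    have B0: "0 \<le> B" using zB norm_ge_zero[of z0] by linarith
    let ?g = "enclosing_loop B"
    have bound: "\<forall>c\<in>set (a[i := z]). norm c \<le> B" if "z \<in> cball z0 1" for z
    proof -
      have "norm z \<le> norm z0 + 1"
        using that norm_triangle_ineq2[of z z0] by (auto simp: dist_norm norm_minus_commute)
      then show ?thesis using zB cB set_update_subset_insert[of a i z] by fastforce
    qed
    have avoid: "path_image (loop_cutoff ?g T) \<inter> Ghat_poles n (a[i := z]) = {}"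
      if "T \<le> ray_top ?g" "z \<in> cball z0 1" for T z
      using left_of_enclosing_loop[OF bound[OF that(2), THEN bspec] B0]
      by (intro loop_cutoff_avoids[OF _ that(1)]) blast
    have "Gamma_poles n ?a \<subseteq> Gamma_poles n (a[i := z0])" 
      using i by (auto simp: Gamma_poles_def upd_conv_take_nth_drop)
    then have avoid': "path_image (loop_cutoff ?g T) \<subseteq> - Ghat_poles n ?a" if "T \<le> ray_top ?g" for T
      using avoid[OF that, of z0] by auto
    have shift: "z + s + (of_nat n - 1) \<notin> \<int>\<^sub>\<le>\<^sub>0"
      if "T \<le> ray_top ?g" "z \<in> cball z0 1" "s \<in> path_image (loop_cutoff ?g T)" for T z s
    proof
      assume "z + s + (of_nat n - 1) \<in> \<int>\<^sub>\<le>\<^sub>0"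
      then have "z + (of_nat n - 1 + s) \<in> \<int>\<^sub>\<le>\<^sub>0" by (simp add: algebra_simps)
      then have "s \<in> Gamma_poles n (a[i := z])"
        using i set_update_memI[of i a z] unfolding nonpos_Int_iff_Gamma_pole Gamma_poles_def by blast
      then show False using avoid[OF that(1,2)] that(3) by auto
    qed
    \<comment> \<open>The released component enters the integrand only through one factor \<open>G (z + s)\<close>.\<close>
    define G where "G w = Gamma (w + (of_nat n - 1))" for w :: complex
    define S where "S = {w. w + (of_nat n - 1) \<notin> (\<int>\<^sub>\<le>\<^sub>0 :: complex set)}"
    have S: "open S"
    proof -
      have "S = (\<lambda>w. w + (of_nat n - 1)) -` (- \<int>\<^sub>\<le>\<^sub>0)" by (auto simp: S_def)
      then show ?thesis by (auto intro!: open_vimage continuous_intros)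
    qed
    have G: "G holomorphic_on S" unfolding G_def S_def by (intro holomorphic_Gamma' holomorphic_intros) auto
    have h: "?h z = (\<lambda>s. G (z + s) * Ghat_kernel n ?a b t s)" for z
      by (intro ext) (simp add: Ghat_kernel_update[OF i] G_def)
    have \<psi>: "continuous_on A (Ghat_kernel n ?a b t)" if "A \<subseteq> path_image (loop_cutoff ?g T)" "T \<le> ray_top ?g" for A T
      using avoid'[OF that(2)] that(1)
      by (intro continuous_on_subset[OF holomorphic_on_imp_continuous_on[OF Ghat_kernel_holomorphic[OF t(1)]]]) auto
    have openP: "open (- Ghat_poles n (a[i := z]))" for z
      using left_discrete_closed[OF left_discrete_Ghat_poles] by blast
    have hol: "(\<lambda>z. contour_integral (loop_cutoff ?g T) (?h z)) holomorphic_on ball z0 1"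
      if T: "T \<le> ray_top ?g" for T
    proof -
      have seg: "(\<lambda>z. contour_integral (linepath u v) (?h z)) holomorphic_on ball z0 1"
        if "closed_segment u v \<subseteq> path_image (loop_cutoff ?g T)" for u v
        unfolding h
      proof (rule holomorphic_on_linepath_integral[OF G S \<psi>[OF that T]])
        show "z + s \<in> S" if "z \<in> ball z0 1" "s \<in> closed_segment u v" for z s
          using shift[OF T, of z s] that \<open>closed_segment u v \<subseteq> _\<close> by (auto simp: S_def)
      qed simp
      have "contour_integral (loop_cutoff ?g T) (?h z) =
        contour_integral (linepath (Complex T (Im (pathstart ?g))) (pathstart ?g)) (?h z) +
        contour_integral ?g (?h z) +
        contour_integral (linepath (pathfinish ?g) (Complex T (Im (pathfinish ?g)))) (?h z)"
        if "z \<in> ball z0 1" for z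
        using avoid[OF T, of z] that
        by (intro contour_integral_loop_cutoff[OF valid_path_linepath openP Ghat_kernel_holomorphic[OF t(1)]]) auto
      moreover have "(\<lambda>z. contour_integral (linepath (Complex T (Im (pathstart ?g))) (pathstart ?g)) (?h z) +
        contour_integral ?g (?h z) +
        contour_integral (linepath (pathfinish ?g) (Complex T (Im (pathfinish ?g)))) (?h z)) holomorphic_on ball z0 1"
        by (intro holomorphic_on_add seg) (auto simp: path_image_loop_cutoff)
      ultimately show ?thesis by (subst holomorphic_cong[OF refl]) auto
    qed
    obtain q R0 where contr: "\<And>a. length a = length b \<Longrightarrow> \<forall>c\<in>set a. norm c \<le> B \<Longrightarrow>
        left_contracting q R0 (Ghat_kernel n a b t)"
      using Ghat_kernel_contracting[OF t] by blast
    define R where "R = min R0 (ray_top ?g)"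
    have R: "left_contracting q R (?h z)" if "z \<in> cball z0 1" for z
      using contr[of "a[i := z]"] bound[OF that] len by (auto simp: left_contracting_def R_def)
    have q: "0 < q" "q < 1" using R[of z0] by (auto simp: left_contracting_def)
    define K where "K = {s. (Im s = Im (pathstart ?g) \<or> Im s = Im (pathfinish ?g)) \<and> R - 1 \<le> Re s \<and> Re s \<le> R}"
    have R1: "R - 1 \<le> ray_top ?g" by (simp add: R_def)
    have K_loop: "K \<subseteq> path_image (loop_cutoff ?g (R - 1))"
      unfolding path_image_loop_cutoff'[OF R1] by (auto simp: K_def R_def ray_top_def)
    have "K = closed_segment (Complex (R - 1) (Im (pathstart ?g))) (Complex R (Im (pathstart ?g))) \<union>
        closed_segment (Complex (R - 1) (Im (pathfinish ?g))) (Complex R (Im (pathfinish ?g)))"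
      using horizontal_segment[of "R - 1" R] by (auto simp: K_def)
    then have "compact K" by (simp add: compact_Un)
    have "continuous_on (cball z0 1 \<times> K) (\<lambda>p. G (fst p + snd p) * Ghat_kernel n ?a b t (snd p))"
    proof (intro continuous_on_mult)
      show "continuous_on (cball z0 1 \<times> K) (\<lambda>p. G (fst p + snd p))"
        using shift[OF R1] K_loop
        by (intro continuous_on_compose2[OF holomorphic_on_imp_continuous_on[OF G]] continuous_intros)
          (auto simp: S_def)
      show "continuous_on (cball z0 1 \<times> K) (\<lambda>p. Ghat_kernel n ?a b t (snd p))"
        by (intro continuous_on_compose2[OF \<psi>[OF K_loop R1]] continuous_intros) auto
    qed
    then have "compact ((\<lambda>p. G (fst p + snd p) * Ghat_kernel n ?a b t (snd p)) ` (cball z0 1 \<times> K))"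
      using \<open>compact K\<close> by (intro compact_continuous_image compact_Times) auto
    then obtain M where "\<forall>w\<in>(\<lambda>p. G (fst p + snd p) * Ghat_kernel n ?a b t (snd p)) ` (cball z0 1 \<times> K). norm w \<le> M"
      using compact_imp_bounded bounded_iff by blast
    then have M: "norm (?h z s) \<le> M" if "z \<in> cball z0 1" "s \<in> K" for z s
      using that unfolding h by fastforce
    let ?L = "\<lambda>k z. contour_integral (loop_cutoff ?g (R - real k)) (?h z)"
    let ?I = "\<lambda>z. 2 * of_real pi * \<i> * enclosing_integral n (a[i := z]) b t"
    have close: "norm (?I z - ?L k z) \<le> q ^ k * (2 * M / (1 - q))" if z: "z \<in> cball z0 1" for z k
    proof -
      have "has_loop_integral (?h z) (?I z) ?g"
        using len B0 bound[OF z] by (intro has_loop_integral_enclosing_loop t) auto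
      then have "((\<lambda>T. contour_integral (loop_cutoff ?g T) (?h z)) \<longlongrightarrow> ?I z) at_bot"
        by (simp add: has_loop_integral_def)
      then have "((\<lambda>T. norm (contour_integral (loop_cutoff ?g T) (?h z) - ?L k z)) \<longlongrightarrow> norm (?I z - ?L k z)) at_bot"
        by (intro tendsto_intros)
      moreover have "\<forall>\<^sub>F T in at_bot. norm (contour_integral (loop_cutoff ?g T) (?h z) - ?L k z) \<le> q ^ k * (2 * M / (1 - q))"
        using eventually_le_at_bot[of "R - real k"]
      proof eventually_elim
        case (elim T)
        show ?case
        proof (rule loop_cutoff_integral_diff_bound[OF valid_path_linepath R[OF z] openP Ghat_kernel_holomorphic[OF t(1)]])
          show "path_image (loop_cutoff ?g T') \<subseteq> - Ghat_poles n (a[i := z])" if "T' \<le> ray_top ?g" for T'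
            using avoid[OF that z] by blast
        qed (use M[OF z] elim in \<open>auto simp: R_def K_def\<close>)
      qed
      ultimately show ?thesis by (intro tendsto_upperbound) auto
    qed
    have "?I holomorphic_on ball z0 1"
    proof (rule holomorphic_uniform_sequence)
      show "?L k holomorphic_on ball z0 1" for k by (rule hol) (simp add: R_def)
      fix x assume "x \<in> ball z0 1"
      then obtain d where d: "0 < d" "cball x d \<subseteq> ball z0 1"
        using open_contains_cball open_ball by blast
      have "uniform_limit (cball x d) ?L ?I sequentially"
      proof (rule uniform_limitI)
        fix e :: real assume "0 < e"
        have "(\<lambda>k. q ^ k * (2 * M / (1 - q))) \<longlonglongrightarrow> 0"
          using q by (intro tendsto_mult_left_zero LIMSEQ_realpow_zero) auto
        then have "\<forall>\<^sub>F k in sequentially. q ^ k * (2 * M / (1 - q)) < e"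
          using \<open>0 < e\<close> by (rule order_tendstoD)
        then show "\<forall>\<^sub>F k in sequentially. \<forall>z\<in>cball x d. dist (?L k z) (?I z) < e"
        proof eventually_elim
          case (elim k)
          show ?case
          proof
            fix z assume "z \<in> cball x d"
            then have "z \<in> cball z0 1" using d(2) ball_subset_cball by blast
            then show "dist (?L k z) (?I z) < e"
              using close[of z k] elim by (simp add: dist_norm norm_minus_commute)
          qed
        qed
      qed
      then show "\<exists>d>0. cball x d \<subseteq> ball z0 1 \<and> uniform_limit (cball x d) ?L ?I sequentially"
        using d by blast
    qed simp
    then have "(\<lambda>z. ?I z / (2 * of_real pi * \<i>)) holomorphic_on ball z0 1"
      by (rule holomorphic_on_divide) (auto intro: holomorphic_on_const)
    then show ?thesis by (rule holomorphic_transform) simp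
  qed
  then show ?thesis
    by (meson UNIV_I centre_in_ball holomorphic_on_def holomorphic_on_imp_differentiable_at
        field_differentiable_at_within open_ball zero_less_one)
qed

section \<open>The value of the loop integral\<close>

text \<open>
  The sequences \<open>1 - c - n - l\<close> miss the points \<open>1 - n + k\<close> exactly because no \<open>-c\<close> is a natural
  number.
\<close>

lemma admissible_loop_exists:
  assumes a: "\<And>c. c \<in> set a \<Longrightarrow> - c \<notin> \<nat>"
  shows "\<exists>g. admissible_loop n a g"
proof -
  define B where "B = Max (insert 0 (norm ` set a))"
  have B: "0 \<le> B" unfolding B_def by (rule Max_ge) auto
  have cB: "norm c \<le> B" if "c \<in> set a" for c unfolding B_def using that by (intro Max_ge) auto
  define R :: "complex set" where "R = range (\<lambda>k. 1 - of_nat n + of_nat k)"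
  \<comment> \<open>Right points have integer real parts, so a half-integer abscissa avoids them.\<close>
  define X :: real where "X = of_int \<lceil>B\<rceil> + 3 / 2"
  have X: "B + 1 < X" unfolding X_def by linarith
  have RX: "finite {z \<in> R. Re z < Y}" for Y
  proof -
    have "{z \<in> R. Re z < Y} \<subseteq> (\<lambda>k. 1 - of_nat n + of_nat k) ` {..nat \<lceil>Y + real n\<rceil>}"
    proof safe
      fix z assume "z \<in> R" "Re z < Y"
      then obtain k where k: "z = 1 - of_nat n + of_nat k" by (auto simp: R_def)
      have "k \<le> nat \<lceil>Y + real n\<rceil>" using \<open>Re z < Y\<close> by (simp add: k) linarith
      then show "z \<in> (\<lambda>k. 1 - of_nat n + of_nat k) ` {..nat \<lceil>Y + real n\<rceil>}" using k by auto
    qed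
    then show ?thesis by (rule finite_subset) auto
  qed
  have "locally_finite_points R"
    unfolding locally_finite_points_def
  proof
    fix Y
    have "R \<inter> cball 0 Y \<subseteq> {z \<in> R. Re z < Y + 1}"
    proof safe
      fix z :: complex assume "z \<in> cball 0 Y"
      then show "Re z < Y + 1" using abs_Re_le_cmod[of z] by simp
    qed
    then show "finite (R \<inter> cball 0 Y)" using RX finite_subset by blast
  qed
  moreover have "Gamma_poles n a \<inter> R = {}"
  proof (rule ccontr)
    assume "Gamma_poles n a \<inter> R \<noteq> {}"
    then obtain p where p: "p \<in> Gamma_poles n a" "p \<in> R" by blast
    then obtain c l where c: "c \<in> set a" "p = 1 - c - of_nat n - of_nat l"
      unfolding Gamma_poles_def by blast
    obtain k where k: "p = 1 - of_nat n + of_nat k" using p(2) unfolding R_def by blast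
    have "1 - c - of_nat n - of_nat l = 1 - of_nat n + of_nat k" by (rule trans[OF c(2)[symmetric] k])
    then have "c + of_nat (k + l) = 0" by (simp add: algebra_simps)
    then have "- c = of_nat (k + l)" by (rule minus_unique)
    then show False using a[OF c(1)] by (metis of_nat_in_Nats)
  qed
  moreover have "Re z \<noteq> X" if z: "z \<in> R" for z
  proof
    assume zX: "Re z = X"
    obtain k where "z = 1 - of_nat n + of_nat k" using z unfolding R_def by blast
    then have "1 - real n + real k = of_int \<lceil>B\<rceil> + 3 / 2" using zX by (simp add: X_def)
    then have "of_int (2 * (1 - int n + int k)) = (of_int (2 * \<lceil>B\<rceil> + 3) :: real)" by simp
    then have "2 * (1 - int n + int k) = 2 * \<lceil>B\<rceil> + 3" by (simp only: of_int_eq_iff)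
    then show False by presburger
  qed
  moreover have "\<bar>Im z\<bar> < B + 1" if "z \<in> R" for z using that B by (auto simp: R_def)
  moreover have "Re p < X" "\<bar>Im p\<bar> < B + 1" if "p \<in> Gamma_poles n a" for p
    using Ghat_poles_bound[OF cB B, of a p n] that X by auto
  ultimately obtain g where g: "left_loop g" "\<forall>z\<in>Gamma_poles n a. left_of_loop g z" "\<forall>z\<in>R. right_of_loop g z"
    using separating_loop_exists[of "Gamma_poles n a" X "B + 1" R]
      left_discrete_locally_finite[OF left_discrete_Gamma_poles] RX B by auto
  then have "admissible_loop n a g"
    unfolding admissible_loop_def by (auto simp: Gamma_poles_def R_def)
  then show ?thesis by blast
qed

lemma has_loop_integral_cong:
  assumes "\<And>T s. T \<le> ray_top g \<Longrightarrow> s \<in> path_image (loop_cutoff g T) \<Longrightarrow> f s = h s"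
  shows "has_loop_integral f v g \<longleftrightarrow> has_loop_integral h v g"
proof -
  have ev: "\<forall>\<^sub>F T in at_bot. contour_integral (loop_cutoff g T) f = contour_integral (loop_cutoff g T) h \<and>
      (f contour_integrable_on loop_cutoff g T \<longleftrightarrow> h contour_integrable_on loop_cutoff g T)"
    using eventually_le_at_bot[of "ray_top g"]
  proof eventually_elim
    case (elim T)
    note eq = assms[OF elim]
    show ?case
      using contour_integral_eq[of "loop_cutoff g T" f h] contour_integrable_eq[of f "loop_cutoff g T" h]
        contour_integrable_eq[of h "loop_cutoff g T" f] eq by auto
  qed
  have "(\<forall>\<^sub>F T in at_bot. f contour_integrable_on loop_cutoff g T) \<longleftrightarrow>
      (\<forall>\<^sub>F T in at_bot. h contour_integrable_on loop_cutoff g T)"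
    by (rule eventually_subst) (use ev in \<open>auto elim: eventually_mono\<close>)
  moreover have "((\<lambda>T. contour_integral (loop_cutoff g T) f) \<longlongrightarrow> v) at_bot \<longleftrightarrow>
      ((\<lambda>T. contour_integral (loop_cutoff g T) h) \<longlongrightarrow> v) at_bot"
    by (rule tendsto_cong) (use ev in \<open>auto elim: eventually_mono\<close>)
  ultimately show ?thesis by (simp add: has_loop_integral_def)
qed

text \<open>
  Every admissible loop is compared with the same enclosing loop. This gives both the independence of
  the loop, which \<^const>\<open>Ghat\<close> presupposes, and the value.
\<close>

lemma Ghat_eq:
  assumes t: "0 < t" "t < 1" and len: "length a = length b" and a: "\<And>c. c \<in> set a \<Longrightarrow> - c \<notin> \<nat>"
  shows "Ghat n a b t = enclosing_integral n a b t +
    Gamma_vec a * (of_real t ^ (n - 1) / fact (n - 1) * hypergeo_over_Gamma n a b (1 / of_real t))"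
    (is "_ = ?I + ?S")
proof -
  have integrand: "has_loop_integral (Ghat_integrand n a b t) v g \<longleftrightarrow> has_loop_integral (Ghat_kernel n a b t) v g"
    if g: "admissible_loop n a g" for g v
  proof (rule has_loop_integral_cong)
    fix T s assume T: "T \<le> ray_top g" "s \<in> path_image (loop_cutoff g T)"
    have "path_image (loop_cutoff g T) \<inter> range (\<lambda>k. 1 - of_nat n + of_nat k) = {}"
      using g by (intro loop_cutoff_avoids[OF _ T(1)]) (auto simp: admissible_loop_def)
    then show "Ghat_integrand n a b t s = Ghat_kernel n a b t s"
      using T(2) by (intro Ghat_integrand_eq_kernel) auto
  qed
  have sides: "left_of_loop g p \<or> right_of_loop g p" if "admissible_loop n a g" "p \<in> Ghat_poles n a" for g p
    using that by (auto simp: admissible_loop_def Gamma_poles_def rational_poles_def)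
  have loop_value: "v / (2 * of_real pi * \<i>) = ?I + ?S"
    if g: "admissible_loop n a g" and v: "has_loop_integral (Ghat_kernel n a b t) v g" for g v
  proof -
    define B where "B = Max (insert 0 (norm ` set a))"
    have B: "0 \<le> B" unfolding B_def by (rule Max_ge) auto
    have cB: "\<forall>c\<in>set a. norm c \<le> B" unfolding B_def by (auto simp del: Max_insert intro: Max_ge)
    have "left_of_loop g p" if "p \<in> Gamma_poles n a" for p
      using g that by (auto simp: admissible_loop_def Gamma_poles_def)
    moreover have "right_of_loop g p" if "p \<in> rational_poles n" for p
      using g that by (auto simp: admissible_loop_def rational_poles_def)
    ultimately have Q: "rational_poles n = {p \<in> Ghat_poles n a. right_of_loop g p}"
      using not_left_and_right by blast
    have vg: "valid_path g" using g by (simp add: admissible_loop_def left_loop_def)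
    have fin: "finite (rational_poles n)" by (simp add: rational_poles_def)
    have left: "left_of_loop (enclosing_loop B) p" if "p \<in> Ghat_poles n a" for p
      using that cB B by (intro left_of_enclosing_loop) auto
    have "v = 2 * pi * \<i> * ?I - 2 * pi * \<i> * (\<Sum>p\<in>rational_poles n. residue (Ghat_kernel n a b t) p)"
      using Ghat_kernel_loop_integral_compare[OF t len vg valid_path_linepath sides[OF g] left Q fin v
        has_loop_integral_enclosing_loop[OF t len B cB]] by simp
    also have "(\<Sum>p\<in>rational_poles n. residue (Ghat_kernel n a b t) p) = - ?S"
      using sum_residues_Ghat_kernel[of t a n b, OF t(1) a] by simp
    finally have "v = 2 * pi * \<i> * ?I - 2 * pi * \<i> * - ?S" .
    then have "v = (?I + ?S) * (2 * of_real pi * \<i>)" by (simp add: algebra_simps)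
    then show ?thesis by simp
  qed
  obtain g where g: "admissible_loop n a g" using admissible_loop_exists[OF a] by blast
  then have "valid_path g" by (simp add: admissible_loop_def left_loop_def)
  then obtain v where v: "has_loop_integral (Ghat_kernel n a b t) v g"
    using Ghat_kernel_loop_integral_exists[OF t len _ sides[OF g]] by blast
  show ?thesis
    unfolding Ghat_def
  proof (rule the_equality)
    show "\<exists>g v. admissible_loop n a g \<and> has_loop_integral (Ghat_integrand n a b t) v g \<and>
        ?I + ?S = v / (2 * of_real pi * \<i>)"
      using g v integrand[OF g] loop_value[OF g v] by metis
    show "w = ?I + ?S" if "\<exists>g v. admissible_loop n a g \<and> has_loop_integral (Ghat_integrand n a b t) v g \<and>
        w = v / (2 * of_real pi * \<i>)" for w
      using that integrand loop_value by metis
  qed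
qed

section \<open>The entire extension of the quotient\<close>

definition Ghat_extension :: "nat \<Rightarrow> complex list \<Rightarrow> real \<Rightarrow> complex list \<Rightarrow> complex" where
  "Ghat_extension n b t a =
     of_real t ^ (n - 1) / fact (n - 1) * hypergeo_over_Gamma n a b (1 / of_real t) +
     (\<Prod>c\<leftarrow>a. rGamma c) * enclosing_integral n a b t"

lemma Ghat_extension_entire:
  assumes "0 < t" "t < 1" "length b = p"
  shows "entire_in_each_component p (Ghat_extension n b t)"
  unfolding entire_in_each_component_def
proof (intro allI impI)
  fix a :: "complex list" and i assume a: "length a = p" "i < p"
  then have i: "i < length a" by simp
  have "(\<lambda>z. hypergeo_over_Gamma n (a[i := z]) b (1 / of_real t)) holomorphic_on UNIV"
    unfolding hypergeo_over_Gamma_def pochhammer_vec_def prod_list_update[OF i] divide_inverse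
    by (intro holomorphic_intros pochhammer_holomorphic)
  moreover have "(\<lambda>z. (\<Prod>c\<leftarrow>a[i := z]. rGamma c)) holomorphic_on UNIV"
    unfolding prod_list_update[OF i] by (intro holomorphic_intros)
  ultimately show "(\<lambda>z. Ghat_extension n b t (a[i := z])) holomorphic_on UNIV"
    unfolding Ghat_extension_def
    using enclosing_integral_holomorphic[OF assms(1,2) _ i, of b n] a assms
    by (intro holomorphic_intros) auto
qed

lemma Ghat_extension_extends:
  assumes "0 < t" "t < 1" "length b = p"
  shows "entire_extension_Ghat_quotient p n b t (Ghat_extension n b t)"
  unfolding entire_extension_Ghat_quotient_def
proof (intro conjI allI impI Ghat_extension_entire[OF assms])
  fix a :: "complex list" assume a: "length a = p" "\<forall>c\<in>set a. - c \<notin> \<nat>"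
  have "Gamma c \<noteq> 0" if "c \<in> set a" for c
    using a(2)[rule_format, OF that] by (auto simp: Gamma_eq_zero_iff elim!: nonpos_Ints_cases')
  then have "Gamma_vec a \<noteq> 0"
    unfolding Gamma_vec_def by (auto simp: prod_list_zero_iff)
  moreover have "Ghat n a b t = enclosing_integral n a b t +
      Gamma_vec a * (of_real t ^ (n - 1) / fact (n - 1) * hypergeo_over_Gamma n a b (1 / of_real t))"
    using a assms by (intro Ghat_eq) auto
  ultimately show "Ghat_extension n b t a = Ghat n a b t / Gamma_vec a"
    unfolding Ghat_extension_def inverse_Gamma_vec[symmetric] by (simp add: field_simps)
qed

text \<open>
  An exceptional point is real, hence the limit of points with nonzero imaginary part.
\<close>

lemma entire_eq_if_eq_off_integers:
  fixes f h :: "complex \<Rightarrow> complex"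
  assumes "f holomorphic_on UNIV" "h holomorphic_on UNIV" "\<And>z. - z \<notin> \<nat> \<Longrightarrow> f z = h z"
  shows "f z = h z"
proof (cases "- z \<in> \<nat>")
  case True
  let ?w = "\<lambda>k::nat. z + of_real (inverse (real (Suc k))) * \<i>"
  have w: "?w \<longlonglongrightarrow> z + of_real 0 * \<i>"
    by (intro tendsto_intros LIMSEQ_inverse_real_of_nat)
  then have w: "?w \<longlonglongrightarrow> z" by simp
  have cont: "isCont f z" "isCont h z"
    using assms by (auto intro: holomorphic_on_imp_continuous_on continuous_on_interior)
  have "f (?w k) = h (?w k)" for k
  proof (rule assms(3))
    obtain m :: nat where "- z = of_nat m" using True by (auto elim: Nats_cases)
    then have "z = - of_nat m" by (metis minus_minus)
    then have "Im (- ?w k) \<noteq> 0" by simp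
    moreover have "Im u = 0" if "u \<in> \<nat>" for u :: complex
      using that by (auto elim: Nats_cases)
    ultimately show "- ?w k \<notin> \<nat>" by blast
  qed
  then have "(\<lambda>k. f (?w k)) = (\<lambda>k. h (?w k))" by auto
  moreover have "(\<lambda>k. f (?w k)) \<longlonglongrightarrow> f z" "(\<lambda>k. h (?w k)) \<longlonglongrightarrow> h z"
    using cont w by (auto intro: isCont_tendsto_compose)
  ultimately show ?thesis using LIMSEQ_unique by metis
qed (use assms in auto)

text \<open>
  Release the components from the genericity condition one at a time: in the released component both
  extensions are entire, and they agree off the nonpositive integers by the previous step.
\<close>

lemma entire_extension_unique:
  assumes F: "entire_extension_Ghat_quotient p n b x F" and F': "entire_extension_Ghat_quotient p n b x F'"
    and "length a = p"
  shows "F a = F' a"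
proof -
  have "F a = F' a" if "length a = p" "\<forall>i. k \<le> i \<longrightarrow> i < p \<longrightarrow> - (a ! i) \<notin> \<nat>" "k \<le> p" for k a
    using that
  proof (induction k arbitrary: a)
    case 0
    then have "\<forall>c\<in>set a. - c \<notin> \<nat>" by (auto simp: in_set_conv_nth)
    then show ?case using 0 F F' by (simp add: entire_extension_Ghat_quotient_def)
  next
    case (Suc k)
    have "F (a[k := z]) = F' (a[k := z])" for z
    proof (rule entire_eq_if_eq_off_integers[where f = "\<lambda>z. F (a[k := z])" and h = "\<lambda>z. F' (a[k := z])"])
      show "(\<lambda>z. F (a[k := z])) holomorphic_on UNIV" "(\<lambda>z. F' (a[k := z])) holomorphic_on UNIV"
        using F F' Suc.prems unfolding entire_extension_Ghat_quotient_def entire_in_each_component_def by auto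
      fix z :: complex assume z: "- z \<notin> \<nat>"
      show "F (a[k := z]) = F' (a[k := z])"
      proof (rule Suc.IH)
        show "\<forall>i. k \<le> i \<longrightarrow> i < p \<longrightarrow> - (a[k := z] ! i) \<notin> \<nat>"
        proof (intro allI impI)
          fix i assume "k \<le> i" "i < p"
          then show "- (a[k := z] ! i) \<notin> \<nat>"
            using z Suc.prems by (cases "i = k") auto
        qed
      qed (use Suc.prems in auto)
    qed
    from this[of "a ! k"] show ?case by simp
  qed
  from this[of a p] show ?thesis using assms(3) by simp
qed

theorem proposition2:
  fixes p n :: nat and b :: "complex list" and x :: real
  assumes "p \<ge> 1" and "length b = p" and "0 < x" and "x < 1"
  shows "(\<exists>F. entire_extension_Ghat_quotient p n b x F) \<and>
    (\<forall>F. entire_extension_Ghat_quotient p n b x F \<longrightarrow>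
      (\<forall>(r::nat) (m::nat list) (a'::complex list).
        1 \<le> r \<longrightarrow> r \<le> p \<longrightarrow> length m = r \<longrightarrow> length a' = p - r \<longrightarrow>
        F (map (\<lambda>k. - of_nat k) m @ a') =
          (if n = 0 then 0
           else of_real x ^ (n - 1) / fact (n - 1) *
             hypergeo_over_Gamma n (map (\<lambda>k. - of_nat k) m @ a') b (1 / of_real x))))"
proof (intro conjI allI impI)
  have E: "entire_extension_Ghat_quotient p n b x (Ghat_extension n b x)"
    using assms by (intro Ghat_extension_extends)
  then show "\<exists>F. entire_extension_Ghat_quotient p n b x F" by blast
  fix F r and m :: "nat list" and a' :: "complex list"
  assume F: "entire_extension_Ghat_quotient p n b x F"
    and r: "1 \<le> r" "r \<le> p" "length m = r" "length a' = p - r"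
  let ?a = "map (\<lambda>k. - of_nat k) m @ a'"
  have "F ?a = Ghat_extension n b x ?a"
    using r by (intro entire_extension_unique[OF F E]) simp
  also have "(\<Prod>c\<leftarrow>?a. rGamma c) = 0"
    using r by (cases m) auto
  then have "Ghat_extension n b x ?a = of_real x ^ (n - 1) / fact (n - 1) * hypergeo_over_Gamma n ?a b (1 / of_real x)"
    unfolding Ghat_extension_def by simp
  also have "\<dots> = (if n = 0 then 0 else of_real x ^ (n - 1) / fact (n - 1) * hypergeo_over_Gamma n ?a b (1 / of_real x))"
    by (simp add: hypergeo_over_Gamma_def)
  finally show "F ?a = (if n = 0 then 0
           else of_real x ^ (n - 1) / fact (n - 1) * hypergeo_over_Gamma n ?a b (1 / of_real x))" .
qed

end
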